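(* Let $v\ge 3$ and let $L(Path(v))$ be the Laplacian matrix of the path on $v$ vertices. For every integer $y\ge 0$, any design with Laplacian matrix $L(Path(v))[y]$ is $D$-optimal, and for every integer $y\ge 1$ any such design is $A$-optimal, among connected designs with Laplacian matrix $L[y]$ with $L\in\mathcal{L}_1(v,v-1,2)$. That is, for every $L\in\mathcal{L}_1(v,v-1,2)$ one has $D(y,L(Path(v)))\ge D(y,L)$ for $y\ge 0$ and $A(y,L(Path(v)))\ge A(y,L)$ for $y\ge 1$.
   Context: A binary block design with $v$ treatments and $b$ blocks of size $2$ is the same thing as a loopless multigraph with $v$ vertices (treatments) and $b$ edges (blocks); its Laplacian matrix is the graph Laplacian $\mathrm{diag}(\delta_1,\dots,\delta_v)-A$, where $A$ is the adjacency matrix (entry $ij$ = number of edges joining $i$ and $j$) and $\delta_i$ are the vertex degrees counted with multiplicity. All designs considered here are assumed connected. Thus $\mathcal{L}_1(v,v-1,2)$ is the set of Laplacian matrices of connected loopless multigraphs with $v$ vertices and $v-1$ edges. $Path(v)$ is the graph with vertices $w_1,\dots,w_v$ and one edge joining $w_i$ and $w_{i+1}$ for each $i=1,\dots,v-1$. For a Laplacian matrix $L$, let $\rho^L_1,\dots,\rho^L_{v-1}$ be its eigenvalues with multiplicity other than one copy of the eigenvalue $0$ of the all-ones vector. For an integer $y\ge0$, $L[y]=L+y(vI_v-J_v)$ ($I_v$ identity, $J_v$ all-ones matrix), the Laplacian of the design obtained by adding $y$ copies of every pair of treatments as blocks. Put $$A(y,L)=\frac{v-1}{\sum_{i=1}^{v-1}\frac{1}{vy+\rho_i^L}},\qquad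 D(y,L)=\prod_{i=1}^{v-1}(vy+\rho_i^L).$$ $A$-optimal ($D$-optimal) means having the maximal value of $A(y,\cdot)$ ($D(y,\cdot)$) in the class considered. *)

theory Defs
  imports "Jordan_Normal_Form.Char_Poly" "HOL-Library.Multiset"
begin

text \<open>
  A binary block design on the treatments \<open>{..<v}\<close> with blocks of size 2, i.e. a loopless
  multigraph, is given by the multiset of its blocks (edges), each block being a 2-element set.
\<close>

definition multigraph :: "nat \<Rightarrow> nat set multiset \<Rightarrow> bool" where
  "multigraph v E \<longleftrightarrow> (\<forall>e \<in># E. e \<subseteq> {..<v} \<and> card e = 2)"

definition connected_multigraph :: "nat \<Rightarrow> nat set multiset \<Rightarrow> bool" where
  "connected_multigraph v E \<longleftrightarrow>
     multigraph v E \<and> (\<forall>i<v. \<forall>j<v. (i, j) \<in> {(a, b). {a, b} \<in># E}\<^sup>*)"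

definition mg_degree :: "nat set multiset \<Rightarrow> nat \<Rightarrow> nat" where
  "mg_degree E i = size {#e \<in># E. i \<in> e#}"

text \<open>On the diagonal \<open>count E {i, i} = count E {i} = 0\<close>, since blocks have two elements.\<close>

definition adjacency :: "nat \<Rightarrow> nat set multiset \<Rightarrow> real mat" where
  "adjacency v E = mat v v (\<lambda>(i, j). real (count E {i, j}))"

definition laplacian :: "nat \<Rightarrow> nat set multiset \<Rightarrow> real mat" where
  "laplacian v E = mat_diag v (\<lambda>i. real (mg_degree E i)) - adjacency v E"

definition laplacians :: "nat \<Rightarrow> nat \<Rightarrow> real mat set" where
  "laplacians v b = {laplacian v E | E. connected_multigraph v E \<and> size E = b}"

text \<open>The vertex \<open>w\<^sub>i\<close> of the path is the number \<open>i - 1\<close>.\<close>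

definition path_graph :: "nat \<Rightarrow> nat set multiset" where
  "path_graph v = {#{i, Suc i}. i \<in># mset_set {..<v - 1}#}"

definition augment :: "nat \<Rightarrow> nat \<Rightarrow> real mat \<Rightarrow> real mat" where
  "augment v y L =
     L + real y \<cdot>\<^sub>m (real v \<cdot>\<^sub>m 1\<^sub>m v - mat v v (\<lambda>_. 1))"

text \<open>
  \<open>proots p\<close> is the multiset of roots of \<open>p\<close> with multiplicity. Laplacian matrices are real
  symmetric, so the real roots of the characteristic polynomial are all the eigenvalues, and
  algebraic and geometric multiplicities agree. One copy of the eigenvalue 0 is removed.
\<close>

definition laplacian_spectrum :: "real mat \<Rightarrow> real multiset" where
  "laplacian_spectrum L = proots (char_poly L) - {#0#}"

definition A_value :: "nat \<Rightarrow> nat \<Rightarrow> real mat \<Rightarrow> real" where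
  "A_value v y L =
     (real v - 1) / (\<Sum>\<rho> \<in># laplacian_spectrum L. 1 / (real v * real y + \<rho>))"

definition D_value :: "nat \<Rightarrow> nat \<Rightarrow> real mat \<Rightarrow> real" where
  "D_value v y L = (\<Prod>\<rho> \<in># laplacian_spectrum L. real v * real y + \<rho>)"

definition designs_over :: "nat \<Rightarrow> nat \<Rightarrow> real mat set \<Rightarrow> nat set multiset set" where
  "designs_over v y \<L> = {E. connected_multigraph v E \<and> laplacian v E \<in> augment v y ` \<L>}"

text \<open>
  Optimality of a design among the connected designs with Laplacian matrix \<open>L[y]\<close>, \<open>L \<in> \<L>\<close>, for
  a criterion \<open>\<Phi>\<close>; a design with Laplacian matrix \<open>L[y]\<close> is assigned the value \<open>\<Phi> v y L\<close>.
\<close>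

definition optimal_design ::
  "(nat \<Rightarrow> nat \<Rightarrow> real mat \<Rightarrow> real) \<Rightarrow> nat \<Rightarrow> nat \<Rightarrow> real mat set \<Rightarrow> nat set multiset \<Rightarrow> bool" where
  "optimal_design \<Phi> v y \<L> E \<longleftrightarrow>
     E \<in> designs_over v y \<L> \<and>
     (\<forall>E' \<in> designs_over v y \<L>. \<forall>L \<in> \<L>. \<forall>L' \<in> \<L>.
        laplacian v E = augment v y L \<longrightarrow> laplacian v E' = augment v y L' \<longrightarrow>
        \<Phi> v y L' \<le> \<Phi> v y L)"

abbreviation "A_optimal \<equiv> optimal_design A_value"
abbreviation "D_optimal \<equiv> optimal_design D_value"

end

theory Submission
  imports Defs "Jordan_Normal_Form.Schur_Decomposition" "HOL-Real_Asymp.Real_Asymp"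
begin

text \<open>
  A connected multigraph with \<open>v\<close> vertices and \<open>n = v - 1\<close> edges is a tree. Put \<open>t = \<rho> - 2\<close> for the
  eigenvalues \<open>\<rho>\<close> other than the trivial one, and \<open>X = x + 2\<close>. Since \<open>\<Sum>t = 0\<close>, comparing
  \<open>\<Sum>1/(x + \<rho>)\<close> amounts to comparing \<open>\<Sum>t\<^sup>2/(X + t)\<close>. Computing traces of powers of the Laplacian gives
  \<open>\<Sum>t\<^sup>2 = 2n - 2 + q\<close> and \<open>\<Sum>t\<^sup>3 \<le> n q\<close> with \<open>q = \<Sum>(\<delta>\<^sub>i - 1)(\<delta>\<^sub>i - 2)\<close>, so Cauchy-Schwarz bounds
  the sum from below by \<open>(2n - 2 + q)\<^sup>2 / (X (2n - 2 + q) + n q)\<close>. For the path \<open>q = 0\<close>, \<open>\<bar>t\<bar> \<le> 2\<close> and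
  \<open>\<Sum>t\<^sup>3 = 0\<close>, which bounds the sum from above by \<open>(2n - 2) X / (X\<^sup>2 - 4)\<close>. A tree with a vertex of degree
  at least 3 has \<open>q \<ge> 2\<close>, and then the lower bound wins for all real \<open>x \<ge> v\<close>; a tree without such a
  vertex is a path. This is the \<open>A\<close>-criterion. For the \<open>D\<close>-criterion with \<open>y \<ge> 1\<close>, integrate the
  inequality over \<open>x\<close> up to infinity, where the ratio of the two products tends to 1. For \<open>y = 0\<close> the
  product of the nontrivial eigenvalues is the same for all trees: it depends only on \<open>v\<close> and the
  determinant of the reduced Laplacian, which is \<open>N N\<^sup>T\<close> with \<open>N\<close> unitriangular.
\<close>

section \<open>Spectra of real symmetric matrices\<close>

definition mat_trace :: "'a :: comm_ring_1 mat \<Rightarrow> 'a" where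
  "mat_trace A = (\<Sum>i<dim_row A. A $$ (i, i))"

lemma index_mult_mat_sum:
  assumes "A \<in> carrier_mat n m" "B \<in> carrier_mat m k" "i < n" "j < k"
  shows "(A * B) $$ (i, j) = (\<Sum>l<m. A $$ (i, l) * B $$ (l, j))"
  using assms by (auto simp: scalar_prod_def atLeast0LessThan)

lemma mat_trace_mult_comm:
  assumes "A \<in> carrier_mat n m" "B \<in> carrier_mat m n"
  shows "mat_trace (A * B) = mat_trace (B * A)"
proof -
  have "mat_trace (A * B) = (\<Sum>i<n. \<Sum>l<m. A $$ (i, l) * B $$ (l, i))"
    using assms unfolding mat_trace_def by (auto simp: index_mult_mat_sum simp del: index_mult_mat(1))
  also have "\<dots> = (\<Sum>l<m. \<Sum>i<n. B $$ (l, i) * A $$ (i, l))"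
    by (subst sum.swap) (simp add: mult.commute)
  also have "\<dots> = mat_trace (B * A)"
    using assms unfolding mat_trace_def by (auto simp: index_mult_mat_sum simp del: index_mult_mat(1))
  finally show ?thesis .
qed

lemma mat_trace_similar:
  assumes "similar_mat A B"
  shows "mat_trace A = mat_trace B"
proof -
  obtain n P Q where c: "{A, B, P, Q} \<subseteq> carrier_mat n n" and "P * Q = 1\<^sub>m n" and
    QP: "Q * P = 1\<^sub>m n" and A: "A = P * B * Q"
    using similar_matD[OF assms] by blast
  have "mat_trace A = mat_trace (Q * (P * B))"
    unfolding A using c by (intro mat_trace_mult_comm[of _ n n]) auto
  also have "Q * (P * B) = B"
    using c QP by (subst assoc_mult_mat[symmetric, of _ n n _ n _ n]) auto
  finally show ?thesis .
qed

lemma upper_triangular_mult_index: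
  assumes "A \<in> carrier_mat n n" "B \<in> carrier_mat n n" "upper_triangular A" "upper_triangular B"
  shows "upper_triangular (A * B)"
    and "i < n \<Longrightarrow> (A * B) $$ (i, i) = A $$ (i, i) * B $$ (i, i)"
proof -
  \<comment> \<open>Below the diagonal every product has a vanishing factor; on it only
    \<open>l = i\<close> survives.\<close>
  have z: "A $$ (i, l) * B $$ (l, j) = 0" if "i < n" "l < n" "j < i \<or> (j = i \<and> l \<noteq> i)" for i j l
  proof (cases "l < i")
    case True
    then show ?thesis using assms that by (auto simp: upper_triangular_def)
  next
    case False
    then have "j < l" using that by auto
    then show ?thesis using assms that by (auto simp: upper_triangular_def)
  qed
  show "upper_triangular (A * B)"
  proof (rule upper_triangularI)
    fix i j assume "j < i" "i < dim_row (A * B)"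
    then show "(A * B) $$ (i, j) = 0"
      using assms z by (subst index_mult_mat_sum[of _ n n _ n]) (auto intro!: sum.neutral)
  qed
  assume i: "i < n"
  have "(A * B) $$ (i, i) = (\<Sum>l<n. A $$ (i, l) * B $$ (l, i))"
    using assms i by (subst index_mult_mat_sum[of _ n n _ n]) auto
  also have "\<dots> = (\<Sum>l<n. if l = i then A $$ (i, i) * B $$ (i, i) else 0)"
    using z i by (intro sum.cong) auto
  finally show "(A * B) $$ (i, i) = A $$ (i, i) * B $$ (i, i)"
    using i by simp
qed

lemma upper_triangular_pow:
  assumes "A \<in> carrier_mat n n" "upper_triangular A"
  shows "upper_triangular (A ^\<^sub>m k) \<and> (\<forall>i<n. (A ^\<^sub>m k) $$ (i, i) = (A $$ (i, i)) ^ k)"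
proof (induction k)
  case 0
  then show ?case using assms by auto
next
  case (Suc k)
  then show ?case
    using assms upper_triangular_mult_index[of "A ^\<^sub>m k" n A] by (auto simp: power_commutes)
qed

lemma proots_prod_linear:
  "proots (\<Prod>a\<leftarrow>as. [:- a, 1 :: 'a :: idom:]) = mset as"
proof (induction as)
  case (Cons a as)
  have "(\<Prod>a\<leftarrow>as. [:- a, 1:]) \<noteq> 0" by (auto simp: prod_list_zero_iff)
  then show ?case
    using Cons by (simp add: proots_mult del: mult_pCons_left)
qed simp

text \<open>By Schur, \<open>A\<close> is similar to a triangular matrix whose diagonal lists the
  roots. Powers keep it triangular and raise the diagonal entrywise, and the trace is a similarity
  invariant.\<close>

lemma sum_proots_power_eq_trace:
  fixes A :: "'a :: conjugatable_ordered_field mat"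
  assumes A: "A \<in> carrier_mat n n" and split: "char_poly A = (\<Prod>a\<leftarrow>as. [:- a, 1:])"
  shows "(\<Sum>x\<in>#proots (char_poly A). x ^ k) = mat_trace (A ^\<^sub>m k)"
proof -
  obtain B where B: "B \<in> carrier_mat n n" "upper_triangular B" and sim: "similar_mat A B"
    using schur_decomposition_exists[OF A split] by auto
  have "char_poly A = (\<Prod>a\<leftarrow>diag_mat B. [:- a, 1:])"
    using char_poly_similar[OF sim] char_poly_upper_triangular[OF B] by simp
  then have "proots (char_poly A) = mset (diag_mat B)"
    by (simp only: proots_prod_linear)
  then have "(\<Sum>x\<in>#proots (char_poly A). x ^ k) = (\<Sum>x\<leftarrow>diag_mat B. x ^ k)"
    by (simp only: mset_map[symmetric] sum_mset_sum_list)
  also have "\<dots> = (\<Sum>i<n. (B $$ (i, i)) ^ k)"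
    using B by (simp add: diag_mat_def sum_list_sum_nth atLeast0LessThan)
  also have "\<dots> = mat_trace (B ^\<^sub>m k)"
    using upper_triangular_pow[OF B, of k] B by (simp add: mat_trace_def)
  also have "\<dots> = mat_trace (A ^\<^sub>m k)"
  proof -
    obtain P Q where "similar_mat_wit A B P Q" using sim by (auto simp: similar_mat_def)
    then have "similar_mat (A ^\<^sub>m k) (B ^\<^sub>m k)"
      using similar_mat_wit_pow unfolding similar_mat_def by blast
    then show ?thesis by (simp add: mat_trace_similar)
  qed
  finally show ?thesis .
qed

section \<open>Reality of the spectrum of a symmetric matrix\<close>

lemma eigenvector_entry:
  assumes A: "A \<in> carrier_mat n n" and ev: "eigenvector A u k" and i: "i < n"
  shows "(\<Sum>j<n. A $$ (i, j) * u $ j) = k * u $ i"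
proof -
  have u: "u \<in> carrier_vec n" and e: "A *\<^sub>v u = k \<cdot>\<^sub>v u"
    using A ev by (auto simp: eigenvector_def)
  have "(A *\<^sub>v u) $ i = (\<Sum>j<n. A $$ (i, j) * u $ j)"
    using A u i by (auto simp: scalar_prod_def atLeast0LessThan)
  then show ?thesis using u i by (simp add: e)
qed

text \<open>The Hermitian form of \<open>A\<close> at an eigenvector equals \<open>k\<close> times
  its squared norm, and symmetry of the real matrix makes this value its own conjugate.\<close>

lemma symmetric_real_eigenvalue_real:
  fixes A :: "real mat"
  assumes A: "A \<in> carrier_mat n n" and sym: "\<And>i j. i < n \<Longrightarrow> j < n \<Longrightarrow> A $$ (i, j) = A $$ (j, i)"
    and ev: "eigenvalue (map_mat complex_of_real A) k"
  shows "k \<in> \<real>"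
proof -
  let ?A = "map_mat complex_of_real A"
  obtain u where u: "eigenvector ?A u k" using ev by (auto simp: eigenvalue_def)
  have cA: "?A \<in> carrier_mat n n" using A by auto
  have uc: "u \<in> carrier_vec n" and u0: "u \<noteq> 0\<^sub>v n" using u A by (auto simp: eigenvector_def)
  obtain i0 where i0: "i0 < n" "u $ i0 \<noteq> 0"
  proof (rule ccontr)
    assume "\<not> thesis"
    then have "u = 0\<^sub>v n" using uc that by (intro eq_vecI) auto
    then show False using u0 by simp
  qed
  define s where "s = (\<Sum>i<n. (cmod (u $ i))\<^sup>2)"
  have s: "s > 0" unfolding s_def using i0 by (intro sum_pos2[of _ i0]) auto
  define h where "h = (\<Sum>i<n. \<Sum>j<n. cnj (u $ i) * (complex_of_real (A $$ (i, j)) * u $ j))"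
  have "h = (\<Sum>i<n. cnj (u $ i) * (k * u $ i))"
    unfolding h_def
  proof (intro sum.cong refl)
    fix i assume "i \<in> {..<n}"
    then have i: "i < n" by simp
    have "(\<Sum>j<n. complex_of_real (A $$ (i, j)) * u $ j) = (\<Sum>j<n. ?A $$ (i, j) * u $ j)"
      using A i by (intro sum.cong) auto
    then show "(\<Sum>j<n. cnj (u $ i) * (complex_of_real (A $$ (i, j)) * u $ j)) = cnj (u $ i) * (k * u $ i)"
      by (simp add: sum_distrib_left[symmetric] eigenvector_entry[OF cA u i])
  qed
  also have "\<dots> = k * of_real s"
    by (simp add: s_def sum_distrib_left complex_norm_square mult_ac del: of_real_power)
  finally have hk: "h = k * of_real s" .
  have "cnj h = (\<Sum>i<n. \<Sum>j<n. u $ i * (complex_of_real (A $$ (i, j)) * cnj (u $ j)))"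
    by (simp add: h_def)
  also have "\<dots> = (\<Sum>j<n. \<Sum>i<n. u $ i * (complex_of_real (A $$ (i, j)) * cnj (u $ j)))"
    by (rule sum.swap)
  also have "\<dots> = h"
    unfolding h_def using sym by (intro sum.cong refl) (auto simp: mult_ac)
  finally have "cnj k * of_real s = k * of_real s" by (simp add: hk)
  then have "cnj k = k" using s by simp
  then show ?thesis by (simp add: Reals_cnj_iff)
qed

text \<open>Over the complex numbers the polynomial factors and all its roots are real; injectivity
  of the embedding carries the factorization back.\<close>

lemma char_poly_symmetric_splits:
  fixes A :: "real mat"
  assumes A: "A \<in> carrier_mat n n" and sym: "\<And>i j. i < n \<Longrightarrow> j < n \<Longrightarrow> A $$ (i, j) = A $$ (j, i)"
  obtains as where "char_poly A = (\<Prod>a\<leftarrow>as. [:- a, 1:])" "length as = n"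
proof -
  let ?A = "map_mat complex_of_real A"
  have cA: "?A \<in> carrier_mat n n" using A by auto
  obtain as where as: "char_poly ?A = (\<Prod>a\<leftarrow>as. [:- a, 1:])" "length as = n"
    using char_poly_factorized[OF cA] by auto
  have "a \<in> \<real>" if "a \<in> set as" for a
  proof -
    have "poly (char_poly ?A) a = 0" using that by (auto simp: as poly_prod_list prod_list_zero_iff)
    then have "eigenvalue ?A a" using eigenvalue_root_char_poly[OF cA] by simp
    then show ?thesis using symmetric_real_eigenvalue_real[OF A sym] by blast
  qed
  then have re: "map (complex_of_real \<circ> Re) as = as" by (simp add: map_idI)
  have "map_poly complex_of_real (char_poly A) = char_poly ?A"
    by (rule of_real_hom.char_poly_hom[OF A, symmetric])
  also have "\<dots> = (\<Prod>a\<leftarrow>map (complex_of_real \<circ> Re) as. [:- a, 1:])" by (simp only: re as)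
  also have "\<dots> = map_poly complex_of_real (\<Prod>a\<leftarrow>map Re as. [:- a, 1:])"
  proof -
    interpret map_poly_comm_ring_hom complex_of_real ..
    show ?thesis by (simp add: hom_prod_list o_def of_real_hom.map_poly_pCons_hom)
  qed
  finally have eq: "map_poly complex_of_real (char_poly A) =
      map_poly complex_of_real (\<Prod>a\<leftarrow>map Re as. [:- a, 1:])" .
  interpret map_poly_inj_comm_ring_hom complex_of_real ..
  have "char_poly A = (\<Prod>a\<leftarrow>map Re as. [:- a, 1:])" using eq by (simp only: eq_iff)
  then show thesis using that[of "map Re as"] as(2) by simp
qed

lemma symmetric_power_sums:
  fixes A :: "real mat"
  assumes A: "A \<in> carrier_mat n n" and sym: "\<And>i j. i < n \<Longrightarrow> j < n \<Longrightarrow> A $$ (i, j) = A $$ (j, i)"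
  shows "size (proots (char_poly A)) = n"
    and "char_poly A = (\<Prod>a\<in>#proots (char_poly A). [:- a, 1:])"
    and "(\<Sum>x\<in>#proots (char_poly A). x) = (\<Sum>i<n. A $$ (i, i))"
    and "(\<Sum>x\<in>#proots (char_poly A). x ^ 2) = (\<Sum>i<n. \<Sum>j<n. A $$ (i, j) * A $$ (j, i))"
    and "(\<Sum>x\<in>#proots (char_poly A). x ^ 3) =
      (\<Sum>i<n. \<Sum>j<n. \<Sum>k<n. A $$ (i, j) * A $$ (j, k) * A $$ (k, i))"
proof -
  obtain as where as: "char_poly A = (\<Prod>a\<leftarrow>as. [:- a, 1:])" "length as = n"
    using char_poly_symmetric_splits[OF A sym] by blast
  have pr: "proots (char_poly A) = mset as" by (simp only: as proots_prod_linear)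
  show "size (proots (char_poly A)) = n" using as pr by simp
  show "char_poly A = (\<Prod>a\<in>#proots (char_poly A). [:- a, 1:])"
    unfolding pr by (simp only: as mset_map[symmetric] prod_mset_prod_list)
  note tr = sum_proots_power_eq_trace[OF A as(1)]
  have "mat_trace (A ^\<^sub>m 1) = (\<Sum>i<n. A $$ (i, i))" using A by (simp add: mat_trace_def)
  then show "(\<Sum>x\<in>#proots (char_poly A). x) = (\<Sum>i<n. A $$ (i, i))" using tr[of 1] by simp
  have p2: "A ^\<^sub>m 2 = A * A" using A by (simp add: numeral_2_eq_2)
  have p3: "A ^\<^sub>m 3 = A * A * A" using A by (simp add: numeral_3_eq_3)
  have AA: "A * A \<in> carrier_mat n n" using A by simp
  show "(\<Sum>x\<in>#proots (char_poly A). x ^ 2) = (\<Sum>i<n. \<Sum>j<n. A $$ (i, j) * A $$ (j, i))"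
    unfolding tr p2 mat_trace_def using A AA by (auto simp: index_mult_mat_sum[OF A A] simp del: index_mult_mat(1))
  have "mat_trace (A * A * A) = (\<Sum>i<n. \<Sum>k<n. (\<Sum>j<n. A $$ (i, j) * A $$ (j, k)) * A $$ (k, i))"
    unfolding mat_trace_def using A AA
    by (auto simp: index_mult_mat_sum[OF A A] index_mult_mat_sum[OF AA A] simp del: index_mult_mat(1) assoc_mult_mat)
  also have "\<dots> = (\<Sum>i<n. \<Sum>k<n. \<Sum>j<n. A $$ (i, j) * A $$ (j, k) * A $$ (k, i))"
    by (simp add: sum_distrib_right)
  also have "\<dots> = (\<Sum>i<n. \<Sum>j<n. \<Sum>k<n. A $$ (i, j) * A $$ (j, k) * A $$ (k, i))"
    by (intro sum.cong refl sum.swap)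
  finally show "(\<Sum>x\<in>#proots (char_poly A). x ^ 3) =
      (\<Sum>i<n. \<Sum>j<n. \<Sum>k<n. A $$ (i, j) * A $$ (j, k) * A $$ (k, i))"
    unfolding tr p3 .
qed

section \<open>Laplacian matrices of multigraphs\<close>

text \<open>Simultaneous relabelling of rows and columns is conjugation by the permutation matrix
  \<open>P\<close> with inverse \<open>Q\<close>.\<close>

lemma char_poly_relabel:
  fixes A B :: "'a :: field mat"
  assumes A: "A \<in> carrier_mat n n" and B: "B \<in> carrier_mat n n" and \<sigma>: "\<sigma> permutes {..<n}"
    and AB: "\<And>i j. i < n \<Longrightarrow> j < n \<Longrightarrow> B $$ (\<sigma> i, \<sigma> j) = A $$ (i, j)"
  shows "char_poly A = char_poly B"
proof -
  define P :: "'a mat" where "P = mat n n (\<lambda>(i, j). if j = \<sigma> i then 1 else 0)"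
  define Q :: "'a mat" where "Q = mat n n (\<lambda>(i, j). if i = \<sigma> j then 1 else 0)"
  have c: "P \<in> carrier_mat n n" "Q \<in> carrier_mat n n" by (auto simp: P_def Q_def)
  have \<sigma>n: "\<sigma> i < n" if "i < n" for i using permutes_in_image[OF \<sigma>, of i] that by simp
  have inj: "\<sigma> i = \<sigma> j \<longleftrightarrow> i = j" for i j using permutes_inj[OF \<sigma>] by (auto dest: injD)
  have PQ: "P * Q = 1\<^sub>m n"
  proof (rule eq_matI)
    fix i j assume "i < dim_row (1\<^sub>m n)" "j < dim_col (1\<^sub>m n)"
    then have ij: "i < n" "j < n" by auto
    have "(P * Q) $$ (i, j) = (\<Sum>l<n. P $$ (i, l) * Q $$ (l, j))"
      by (rule index_mult_mat_sum[OF c ij])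
    also have "\<dots> = (\<Sum>l<n. if l = \<sigma> i then (if l = \<sigma> j then 1 else 0) else 0)"
      by (intro sum.cong refl) (use ij in \<open>simp add: P_def Q_def\<close>)
    finally have "(P * Q) $$ (i, j) = (\<Sum>l<n. if l = \<sigma> i then (if l = \<sigma> j then 1 else 0) else 0)" .
    then show "(P * Q) $$ (i, j) = 1\<^sub>m n $$ (i, j)" using ij \<sigma>n by (simp add: inj)
  qed (use c in auto)
  have QP: "Q * P = 1\<^sub>m n" by (rule mat_mult_left_right_inverse[OF c PQ])
  have "A = P * B * Q"
  proof (rule eq_matI)
    fix i j assume "i < dim_row (P * B * Q)" "j < dim_col (P * B * Q)"
    then have ij: "i < n" "j < n" using c by auto
    have PB: "(P * B) $$ (i, l) = B $$ (\<sigma> i, l)" if "l < n" for l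
    proof -
      have "(P * B) $$ (i, l) = (\<Sum>m<n. P $$ (i, m) * B $$ (m, l))"
        by (rule index_mult_mat_sum[OF c(1) B ij(1) that])
      also have "\<dots> = (\<Sum>m<n. if m = \<sigma> i then B $$ (m, l) else 0)"
        by (intro sum.cong refl) (use ij in \<open>simp add: P_def\<close>)
      finally have "(P * B) $$ (i, l) = (\<Sum>m<n. if m = \<sigma> i then B $$ (m, l) else 0)" .
      then show ?thesis using \<sigma>n ij by simp
    qed
    have "(P * B * Q) $$ (i, j) = (\<Sum>l<n. (P * B) $$ (i, l) * Q $$ (l, j))"
      by (rule index_mult_mat_sum[OF _ c(2) ij]) (use B c in auto)
    also have "\<dots> = (\<Sum>l<n. if l = \<sigma> j then B $$ (\<sigma> i, l) else 0)"
      by (intro sum.cong refl) (use ij PB in \<open>simp add: Q_def del: index_mult_mat(1)\<close>)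
    finally have "(P * B * Q) $$ (i, j) = (\<Sum>l<n. if l = \<sigma> j then B $$ (\<sigma> i, l) else 0)" .
    then show "A $$ (i, j) = (P * B * Q) $$ (i, j)" using \<sigma>n ij AB by simp
  qed (use A c in auto)
  then have "similar_mat A B"
    using A B c PQ QP by (intro similar_matI[of _ _ P Q n]) auto
  then show ?thesis by (rule char_poly_similar)
qed

text \<open>Conjugation by the matrix that adds all columns to column \<open>0\<close> makes that column zero.\<close>
lemma char_poly_zero_sums:
  fixes A :: "'a :: field mat"
  assumes A: "A \<in> carrier_mat (Suc n) (Suc n)"
    and rows: "\<And>i. i < Suc n \<Longrightarrow> (\<Sum>j<Suc n. A $$ (i, j)) = 0"
  shows "char_poly A = [:0, 1:] * char_poly (mat n n (\<lambda>(i, j). A $$ (Suc i, Suc j) - A $$ (0, Suc j)))"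
proof -
  let ?n = "Suc n"
  define P :: "'a mat" where "P = mat ?n ?n (\<lambda>(i, j). if i = j \<or> j = 0 then 1 else 0)"
  define Q :: "'a mat" where "Q = mat ?n ?n (\<lambda>(i, j). if i = j then 1 else if j = 0 then - 1 else 0)"
  have c: "P \<in> carrier_mat ?n ?n" "Q \<in> carrier_mat ?n ?n" by (auto simp: P_def Q_def)
  \<comment> \<open>Left multiplication by \<open>Q\<close> subtracts row \<open>0\<close> from
    every other row.\<close>
  have QB: "(Q * B) $$ (i, j) = (if i = 0 then B $$ (0, j) else B $$ (i, j) - B $$ (0, j))"
    if "B \<in> carrier_mat ?n ?n" "i < ?n" "j < ?n" for B i j
  proof -
    have "(Q * B) $$ (i, j) = (\<Sum>l<?n. (if l = i then B $$ (l, j) else 0) -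
        (if l = 0 then if i = 0 then 0 else B $$ (l, j) else 0))"
      using that by (subst index_mult_mat_sum[OF c(2) that(1)]) (auto simp: Q_def intro!: sum.cong)
    also have "\<dots> = (if i = 0 then B $$ (0, j) else B $$ (i, j) - B $$ (0, j))"
      unfolding sum_subtractf sum.delta[OF finite_lessThan] using that by simp
    finally show ?thesis .
  qed
  have QP: "Q * P = 1\<^sub>m ?n"
  proof (rule eq_matI)
    fix i j assume "i < dim_row (1\<^sub>m ?n)" "j < dim_col (1\<^sub>m ?n)"
    then show "(Q * P) $$ (i, j) = 1\<^sub>m ?n $$ (i, j)"
      using QB[OF c(1), of i j] by (auto simp: P_def)
  qed (use c in auto)
  have PQ: "P * Q = 1\<^sub>m ?n" by (rule mat_mult_left_right_inverse[OF c(2,1) QP])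
  define B where "B = Q * (A * P)"
  have AP: "A * P \<in> carrier_mat ?n ?n" using A c by simp
  have B: "B \<in> carrier_mat ?n ?n" using AP c by (simp add: B_def)
  have "P * B = P * Q * (A * P)"
    unfolding B_def by (rule assoc_mult_mat[symmetric, OF c AP])
  also have "\<dots> = A * P" unfolding PQ by (rule left_mult_one_mat[OF AP])
  finally have "P * B * Q = A * P * Q" by simp
  also have "\<dots> = A * (P * Q)" by (rule assoc_mult_mat[OF A c])
  also have "\<dots> = A" using A by (simp add: PQ)
  finally have "A = P * B * Q" by simp
  then have sim: "similar_mat A B"
    using A B c PQ QP by (intro similar_matI[of _ _ P Q ?n]) auto
  \<comment> \<open>Column \<open>0\<close> of \<open>P\<close> is all ones, so this column of
    \<open>A * P\<close> collects the row sums.\<close>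
  have AP0: "(A * P) $$ (i, 0) = 0" if "i < ?n" for i
  proof -
    have "(A * P) $$ (i, 0) = (\<Sum>l<?n. A $$ (i, l) * P $$ (l, 0))"
      by (rule index_mult_mat_sum[OF A c(1) that]) simp
    also have "\<dots> = (\<Sum>l<?n. A $$ (i, l))"
      by (intro sum.cong refl) (simp add: P_def)
    finally have "(A * P) $$ (i, 0) = (\<Sum>l<?n. A $$ (i, l))" .
    then show ?thesis using rows that by simp
  qed
  have AP1: "(A * P) $$ (i, Suc j) = A $$ (i, Suc j)" if "i < ?n" "j < n" for i j
  proof -
    have "(A * P) $$ (i, Suc j) = (\<Sum>l<?n. A $$ (i, l) * P $$ (l, Suc j))"
      by (rule index_mult_mat_sum[OF A c(1) that(1)]) (use that in simp)
    also have "\<dots> = (\<Sum>l<?n. if l = Suc j then A $$ (i, l) else 0)"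
      by (intro sum.cong refl) (use that in \<open>simp add: P_def\<close>)
    finally have "(A * P) $$ (i, Suc j) = (\<Sum>l<?n. if l = Suc j then A $$ (i, l) else 0)" .
    then show ?thesis using that by simp
  qed
  have "B $$ (i, 0) = 0" if "i < ?n" for i
    using that by (simp add: B_def QB[OF AP] AP0 del: index_mult_mat(1))
  \<comment> \<open>Expansion along the zero column splits off the factor belonging to the
    eigenvalue 0.\<close>
  then have "char_poly A = monom 1 1 * char_poly (mat_delete B 0 0)"
    using char_poly_similar[OF sim] char_poly_0_column[OF _ B, of 0] by simp
  also have "mat_delete B 0 0 = mat n n (\<lambda>(i, j). A $$ (Suc i, Suc j) - A $$ (0, Suc j))"
  proof (rule eq_matI)
    fix i j
    assume "i < dim_row (mat n n (\<lambda>(i, j). A $$ (Suc i, Suc j) - A $$ (0, Suc j)))"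
      and "j < dim_col (mat n n (\<lambda>(i, j). A $$ (Suc i, Suc j) - A $$ (0, Suc j)))"
    then have ij: "i < n" "j < n" by auto
    have "B $$ (Suc i, Suc j) = A $$ (Suc i, Suc j) - A $$ (0, Suc j)"
      using ij by (simp add: B_def QB[OF AP] AP1 del: index_mult_mat(1))
    then show "mat_delete B 0 0 $$ (i, j) =
        mat n n (\<lambda>(i, j). A $$ (Suc i, Suc j) - A $$ (0, Suc j)) $$ (i, j)"
      using ij B by (simp add: mat_delete_def)
  qed (use B in auto)
  also have "monom 1 1 = [:0, 1 :: 'a:]" by (simp add: monom_altdef)
  finally show ?thesis .
qed

lemma poly_char_poly_0:
  fixes A :: "'a :: field mat"
  assumes "A \<in> carrier_mat n n"
  shows "poly (char_poly A) 0 = (- 1) ^ n * det A"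
proof -
  have "- char_matrix A 0 = (- 1) \<cdot>\<^sub>m A"
    using assms by (intro eq_matI) (auto simp: char_matrix_def)
  then show ?thesis using assms by (simp add: char_poly_matrix[OF assms])
qed

text \<open>Each edge at \<open>i\<close> has exactly one other endpoint, blocks having two
  elements, so it is counted for exactly one \<open>j\<close>.\<close>

lemma mg_degree_eq_sum_count:
  assumes "multigraph v E" "i < v"
  shows "mg_degree E i = (\<Sum>j<v. count E {i, j})"
  using assms
proof (induction E)
  case (add e E)
  have e: "e \<subseteq> {..<v}" "card e = 2" and E: "multigraph v E"
    using add.prems by (auto simp: multigraph_def)
  obtain a b where ab: "e = {a, b}" "a \<noteq> b" using e by (auto simp: card_2_iff)
  have one_edge: "(\<Sum>j<v. if e = {i, j} then 1 else 0) = (if i \<in> e then 1 else 0 :: nat)"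
  proof (cases "i \<in> e")
    case True
    then obtain c where c: "e = {i, c}" "i \<noteq> c" using ab by auto
    have "e = {i, j} \<longleftrightarrow> j = c" for j using c by (auto simp: doubleton_eq_iff)
    then show ?thesis using True c e by simp
  qed auto
  have "(\<Sum>j<v. count (add_mset e E) {i, j}) =
      (\<Sum>j<v. (if e = {i, j} then 1 else 0) + count E {i, j})"
    by (intro sum.cong) auto
  also have "\<dots> = (if i \<in> e then 1 else 0) + (\<Sum>j<v. count E {i, j})"
    by (simp only: sum.distrib one_edge)
  also have "\<dots> = (if i \<in> e then 1 else 0) + mg_degree E i"
    by (simp only: add.IH[OF E add.prems(2)])
  also have "\<dots> = mg_degree (add_mset e E) i"
    by (simp add: mg_degree_def)
  finally show ?case by (rule sym)
qed (simp add: mg_degree_def)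

text \<open>Handshake lemma: every edge is counted at its two endpoints.\<close>

lemma sum_mg_degree:
  assumes "multigraph v E"
  shows "(\<Sum>i<v. mg_degree E i) = 2 * size E"
  using assms
proof (induction E)
  case (add e E)
  have e: "e \<subseteq> {..<v}" "card e = 2" and E: "multigraph v E"
    using add.prems by (auto simp: multigraph_def)
  have "mg_degree (add_mset e E) i = (if i \<in> e then 1 else 0) + mg_degree E i" for i
    by (simp add: mg_degree_def)
  moreover have "(\<Sum>i<v. if i \<in> e then 1 else 0 :: nat) = 2"
    using e by (simp add: sum.If_cases Int_absorb1)
  ultimately show ?case using add.IH[OF E] by (simp add: sum.distrib)
qed (simp add: mg_degree_def)

lemma laplacian_carrier [simp]: "laplacian v E \<in> carrier_mat v v"
  unfolding laplacian_def by (rule minus_carrier_mat) (simp add: adjacency_def)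

lemma laplacian_index:
  "i < v \<Longrightarrow> j < v \<Longrightarrow>
    laplacian v E $$ (i, j) = (if i = j then real (mg_degree E i) else 0) - real (count E {i, j})"
  by (simp add: laplacian_def adjacency_def mat_diag_def)

lemma laplacian_symmetric:
  "i < v \<Longrightarrow> j < v \<Longrightarrow> laplacian v E $$ (i, j) = laplacian v E $$ (j, i)"
  by (simp add: laplacian_index insert_commute)

lemma laplacian_row_sum:
  assumes "multigraph v E" "i < v"
  shows "(\<Sum>j<v. laplacian v E $$ (i, j)) = 0"
proof -
  have "(\<Sum>j<v. laplacian v E $$ (i, j)) =
      (\<Sum>j<v. if i = j then real (mg_degree E i) else 0) - (\<Sum>j<v. real (count E {i, j}))"
    unfolding sum_subtractf[symmetric] using assms by (intro sum.cong) (auto simp: laplacian_index)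
  then show ?thesis using assms by (simp add: mg_degree_eq_sum_count)
qed

lemma mg_degree_relabel:
  assumes "inj \<sigma>"
  shows "mg_degree (image_mset (image \<sigma>) E) (\<sigma> i) = mg_degree E i"
  using assms by (simp add: mg_degree_def filter_mset_image_mset inj_image_mem_iff)

lemma laplacian_spectrum_relabel:
  assumes "\<sigma> permutes {..<v}"
  shows "laplacian_spectrum (laplacian v (image_mset (image \<sigma>) E)) = laplacian_spectrum (laplacian v E)"
proof -
  have inj: "inj \<sigma>" by (rule permutes_inj[OF assms])
  have "count (image_mset (image \<sigma>) E) {\<sigma> i, \<sigma> j} = count E {i, j}" for i j
  proof -
    have "count (image_mset (image \<sigma>) E) (\<sigma> ` {i, j}) = count E {i, j}"
      using inj by (induction E) (auto simp: inj_image_eq_iff simp del: image_insert)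
    then show ?thesis by simp
  qed
  then have "char_poly (laplacian v E) = char_poly (laplacian v (image_mset (image \<sigma>) E))"
    using inj permutes_in_image[OF assms]
    by (intro char_poly_relabel[OF _ _ assms]) (auto simp: laplacian_index mg_degree_relabel inj_eq)
  then show ?thesis by (simp add: laplacian_spectrum_def)
qed

section \<open>Trees given by parent maps\<close>

text \<open>Vertex \<open>0\<close> is the root and \<open>p\<close> gives the parents, so the edges
  are indexed by the other vertices.\<close>

definition tree_graph :: "nat \<Rightarrow> (nat \<Rightarrow> nat) \<Rightarrow> nat set multiset" where
  "tree_graph v p = {#{i, p i}. i \<in># mset_set {1..<v}#}"

text \<open>Parents precede their children, which excludes cycles and later makes the incidence
  matrix triangular.\<close>

definition parent_map :: "nat \<Rightarrow> (nat \<Rightarrow> nat) \<Rightarrow> bool" where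
  "parent_map v p \<longleftrightarrow> (\<forall>i\<in>{1..<v}. p i < i)"

lemma parent_mapD: "parent_map v p \<Longrightarrow> 1 \<le> i \<Longrightarrow> i < v \<Longrightarrow> p i < i"
  by (simp add: parent_map_def)

text \<open>An edge determines its index as its larger endpoint.\<close>

lemma tree_edge_inj:
  assumes "parent_map v p"
  shows "inj_on (\<lambda>i. {i, p i}) {1..<v}"
proof (rule inj_onI)
  fix i j assume ij: "i \<in> {1..<v}" "j \<in> {1..<v}" and e: "{i, p i} = {j, p j}"
  then have "p i < i" "p j < j" using assms by (auto simp: parent_map_def)
  then show "i = j" using e by (auto simp: doubleton_eq_iff)
qed

lemma size_filter_tree_graph:
  "size {#e \<in># tree_graph v p. Q e#} = (\<Sum>k=1..<v. if Q {k, p k} then 1 else 0)"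
  by (simp add: tree_graph_def filter_mset_image_mset filter_mset_mset_set sum.If_cases
      Int_def conj_commute)

lemma count_tree_graph_sum:
  "count (tree_graph v p) e = (\<Sum>k=1..<v. if {k, p k} = e then 1 else 0)"
  using size_filter_tree_graph[of "\<lambda>x. x = e" v p] by (simp add: filter_eq_replicate_mset)

lemma multigraph_tree_graph:
  assumes "parent_map v p"
  shows "multigraph v (tree_graph v p)"
  unfolding multigraph_def
proof
  fix e assume "e \<in># tree_graph v p"
  then obtain i where i: "i \<in> {1..<v}" "e = {i, p i}" by (auto simp: tree_graph_def)
  then have "p i < i" "i < v" using assms by (auto simp: parent_map_def)
  then show "e \<subseteq> {..<v} \<and> card e = 2" using i by auto
qed

lemma size_tree_graph: "size (tree_graph v p) = v - 1"
  by (simp add: tree_graph_def)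

lemma path_graph_eq_tree_graph: "path_graph v = tree_graph v (\<lambda>i. i - 1)"
proof -
  have "mset_set {1..<v} = image_mset Suc (mset_set {..<v - 1})"
  proof (subst image_mset_mset_set)
    show "mset_set {1..<v} = mset_set (Suc ` {..<v - 1})"
      by (rule arg_cong[of _ _ mset_set]) (cases v; simp add: image_Suc_lessThan atLeastLessThanSuc_atLeastAtMost)
  qed simp
  then show ?thesis
    by (simp add: path_graph_def tree_graph_def image_mset.compositionality o_def insert_commute)
qed

text \<open>Row \<open>i\<close> belongs to the vertex \<open>i + 1\<close> (the root \<open>0\<close> is left out) and column \<open>k\<close> to the edge
  from \<open>k + 1\<close> to its parent.\<close>
definition reduced_incidence :: "nat \<Rightarrow> (nat \<Rightarrow> nat) \<Rightarrow> real mat" where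
  "reduced_incidence n p = mat n n (\<lambda>(i, k). (if i = k then 1 else 0) - (if Suc i = p (Suc k) then 1 else 0))"

text \<open>The oriented incidence matrix \<open>?N\<close> without the root row is upper
  unitriangular because parents come first, and the reduced Laplacian is \<open>?N\<close> times its
  transpose. This is the matrix-tree theorem for a single tree.\<close>

lemma det_reduced_laplacian_tree:
  assumes p: "parent_map (Suc n) p"
  shows "det (mat n n (\<lambda>(i, j). laplacian (Suc n) (tree_graph (Suc n) p) $$ (Suc i, Suc j))) = 1"
    (is "det ?M = 1")
proof -
  let ?N = "reduced_incidence n p"
  have N: "?N \<in> carrier_mat n n" by (simp add: reduced_incidence_def)
  have pk: "p (Suc k) < Suc k" if "k < n" for k using parent_mapD[OF p, of "Suc k"] that by simp
  have ut: "upper_triangular ?N"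
  proof (rule upper_triangularI)
    fix i j assume "j < i" "i < dim_row ?N"
    then show "?N $$ (i, j) = 0" using pk[of j] by (auto simp: reduced_incidence_def)
  qed
  have "diag_mat ?N = map (\<lambda>i. 1) [0..<n]"
    using pk by (fastforce simp: diag_mat_def reduced_incidence_def)
  then have detN: "det ?N = 1"
  proof -
    have "prod_list (map (\<lambda>i. 1) xs) = (1 :: real)" for xs :: "nat list" by (induction xs) auto
    then show ?thesis using det_upper_triangular[OF ut N] \<open>diag_mat ?N = _\<close> by simp
  qed
  have "?M = ?N * transpose_mat ?N"
  proof (rule eq_matI)
    fix i j assume "i < dim_row (?N * transpose_mat ?N)" "j < dim_col (?N * transpose_mat ?N)"
    then have ij: "i < n" "j < n" using N by auto
    have "(?N * transpose_mat ?N) $$ (i, j) = (\<Sum>k<n. ?N $$ (i, k) * transpose_mat ?N $$ (k, j))"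
      by (rule index_mult_mat_sum[OF N _ ij]) (use N in simp)
    \<comment> \<open>Edge by edge: a diagonal entry counts the edges at its vertex, an off-diagonal
      one subtracts the edges joining the two vertices.\<close>
    also have "\<dots> = (\<Sum>k<n. (if i = j then if Suc i \<in> {Suc k, p (Suc k)} then 1 else 0 else 0) -
        (if {Suc k, p (Suc k)} = {Suc i, Suc j} then 1 else 0))"
    proof (intro sum.cong refl)
      fix k assume "k \<in> {..<n}"
      then have k: "k < n" "p (Suc k) \<noteq> Suc k" using pk by (auto simp: less_imp_neq)
      then show "?N $$ (i, k) * transpose_mat ?N $$ (k, j) =
          (if i = j then if Suc i \<in> {Suc k, p (Suc k)} then 1 else 0 else 0) -
          (if {Suc k, p (Suc k)} = {Suc i, Suc j} then 1 else 0)"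
        using ij N by (auto simp: reduced_incidence_def doubleton_eq_iff)
    qed
    also have "\<dots> = (\<Sum>k=1..<Suc n. (if i = j then if Suc i \<in> {k, p k} then 1 else 0 else 0) -
        (if {k, p k} = {Suc i, Suc j} then 1 else 0))"
      by (simp only: One_nat_def sum.shift_bounds_Suc_ivl atLeast0LessThan)
    also have "\<dots> = (if i = j then real (mg_degree (tree_graph (Suc n) p) (Suc i)) else 0) -
        real (count (tree_graph (Suc n) p) {Suc i, Suc j})"
      by (simp add: sum_subtractf mg_degree_def size_filter_tree_graph count_tree_graph_sum
          if_distrib[of real] cong: if_cong)
    also have "\<dots> = ?M $$ (i, j)" using ij by (simp add: laplacian_index)
    finally show "?M $$ (i, j) = (?N * transpose_mat ?N) $$ (i, j)" by (rule sym)
  qed (use N in auto)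
  then have "det ?M = det ?N * det (transpose_mat ?N)" using N by (simp add: det_mult[of _ n])
  then show ?thesis using detN det_transpose[OF N] by simp
qed

text \<open>Row sums vanish, so one root 0 splits off, and the product of the other roots is read
  off the constant term of the remaining factor. The first determinant, of identity plus all-ones
  matrix, depends on \<open>n\<close> only and is left unevaluated.\<close>

lemma laplacian_spectrum_split:
  assumes E: "multigraph (Suc n) E"
  defines "L \<equiv> laplacian (Suc n) E"
  shows "proots (char_poly L) = add_mset 0 (laplacian_spectrum L)"
    and "size (laplacian_spectrum L) = n"
    and "(\<Prod>\<rho>\<in>#laplacian_spectrum L. \<rho>) = det (mat n n (\<lambda>(i, j). (if i = j then 2 else 1) :: real)) *
      det (mat n n (\<lambda>(i, j). L $$ (Suc i, Suc j)))"
proof -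
  let ?L' = "mat n n (\<lambda>(i, j). L $$ (Suc i, Suc j) - L $$ (0, Suc j))"
  let ?J = "mat n n (\<lambda>(i, j). (if i = j then 2 else 1) :: real)"
  let ?M = "mat n n (\<lambda>(i, j). L $$ (Suc i, Suc j))"
  have L: "L \<in> carrier_mat (Suc n) (Suc n)" by (simp add: L_def)
  have rows: "(\<Sum>j<Suc n. L $$ (i, j)) = 0" if "i < Suc n" for i
    unfolding L_def by (rule laplacian_row_sum[OF E that])
  note sps = symmetric_power_sums[OF L, unfolded L_def, OF laplacian_symmetric, folded L_def]
  \<comment> \<open>Column sums vanish too, so \<open>?L'\<close> is the reduced Laplacian \<open>?M\<close> multiplied by \<open>?J\<close>.\<close>
  have cp: "char_poly L = [:0, 1:] * char_poly ?L'" by (rule char_poly_zero_sums[OF L rows])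
  have L'0: "char_poly ?L' \<noteq> 0"
    using degree_monic_char_poly[of ?L' n] by force
  have "proots (char_poly L) = add_mset 0 (proots (char_poly ?L'))"
    unfolding cp by (subst proots_mult) (use L'0 in auto)
  then show pr: "proots (char_poly L) = add_mset 0 (laplacian_spectrum L)"
    by (simp add: laplacian_spectrum_def)
  then show sz: "size (laplacian_spectrum L) = n" using sps(1) by simp
  have "[:0, 1:] * char_poly ?L' = [:0, 1:] * (\<Prod>a\<in>#laplacian_spectrum L. [:- a, 1:])"
    using sps(2) unfolding pr cp[symmetric] by (simp del: mult_pCons_left)
  then have "char_poly ?L' = (\<Prod>a\<in>#laplacian_spectrum L. [:- a, 1:])"
    by (subst (asm) mult_cancel_left) simp
  then have "(- 1) ^ n * det ?L' = poly (\<Prod>a\<in>#laplacian_spectrum L. [:- a, 1:]) 0"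
    using poly_char_poly_0[of ?L' n] by simp
  also have "poly (\<Prod>a\<in>#M. [:- a, 1:]) 0 = (- 1) ^ size M * (\<Prod>\<rho>\<in>#M. \<rho>)" for M :: "real multiset"
    by (induction M) auto
  finally have "(\<Prod>\<rho>\<in>#laplacian_spectrum L. \<rho>) = det ?L'" by (simp add: sz)
  also have "?L' = ?J * ?M"
  proof (rule eq_matI)
    fix i j assume "i < dim_row (?J * ?M)" "j < dim_col (?J * ?M)"
    then have ij: "i < n" "j < n" by auto
    have "(?J * ?M) $$ (i, j) = (\<Sum>k<n. ?J $$ (i, k) * ?M $$ (k, j))"
      by (rule index_mult_mat_sum[OF _ _ ij]) auto
    \<comment> \<open>Row \<open>i\<close> of \<open>?J\<close> picks one copy of row
      \<open>i\<close> of \<open>?M\<close> plus a column sum over all rows but row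
      \<open>0\<close>, which is minus the entry in row \<open>0\<close> of
      \<open>L\<close>.\<close>
    also have "\<dots> = (\<Sum>k<n. (if k = i then L $$ (Suc k, Suc j) else 0) + L $$ (Suc k, Suc j))"
      by (intro sum.cong refl) (use ij in auto)
    also have "\<dots> = L $$ (Suc i, Suc j) + (\<Sum>k<n. L $$ (Suc k, Suc j))"
      using ij by (simp add: sum.distrib)
    also have "(\<Sum>k<n. L $$ (Suc k, Suc j)) = (\<Sum>k<n. L $$ (Suc j, Suc k))"
      unfolding L_def by (intro sum.cong refl laplacian_symmetric) (use ij in auto)
    also have "\<dots> = - L $$ (Suc j, 0)"
      using rows[of "Suc j"] ij by (simp add: sum.lessThan_Suc_shift del: sum.lessThan_Suc)
    also have "L $$ (Suc j, 0) = L $$ (0, Suc j)"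
      unfolding L_def by (intro laplacian_symmetric) (use ij in auto)
    finally show "?L' $$ (i, j) = (?J * ?M) $$ (i, j)" using ij by simp
  qed auto
  also have "det (?J * ?M) = det ?J * det ?M" by (rule det_mult) auto
  finally show "(\<Prod>\<rho>\<in>#laplacian_spectrum L. \<rho>) = det ?J * det ?M" .
qed

text \<open>A spanning tree is grown from the root \<open>r\<close>: while vertices are missing,
  connectivity yields an edge leaving the set reached so far, and its outer end is numbered
  next.\<close>

lemma partial_ordering:
  assumes conn: "connected_multigraph v E" and r: "r < v" and k: "1 \<le> k" "k \<le> v"
  shows "\<exists>\<sigma> p. inj_on \<sigma> {..<k} \<and> \<sigma> ` {..<k} \<subseteq> {..<v} \<and> \<sigma> 0 = r \<and>
    (\<forall>i\<in>{1..<k}. p i < i \<and> {\<sigma> i, \<sigma> (p i)} \<in># E)"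
  using k
proof (induction k rule: nat_induct_at_least)
  case base
  show ?case using r by (intro exI[of _ "\<lambda>_. r"]) (auto simp: inj_on_def)
next
  case (Suc k)
  then obtain \<sigma> p where \<sigma>: "inj_on \<sigma> {..<k}" "\<sigma> ` {..<k} \<subseteq> {..<v}" "\<sigma> 0 = r"
    and "\<forall>i\<in>{1..<k}. p i < i \<and> {\<sigma> i, \<sigma> (p i)} \<in># E"
    by auto
  then have p: "p i < i \<and> {\<sigma> i, \<sigma> (p i)} \<in># E" if "i \<in> {1..<k}" for i using that by blast
  let ?S = "\<sigma> ` {..<k}"
  have "card ?S = k" using card_image[OF \<sigma>(1)] by simp
  then have "?S \<noteq> {..<v}" using Suc.prems by auto
  then obtain w where w: "w < v" "w \<notin> ?S" using \<sigma>(2) by auto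
  have "r \<in> ?S" using \<sigma>(3) Suc.hyps by force
  have "(r, w) \<in> {(a, b). {a, b} \<in># E}\<^sup>*"
    using conn r w by (auto simp: connected_multigraph_def)
  \<comment> \<open>A walk from \<open>r\<close> inside \<open>?S\<close> to \<open>w\<close>
    outside must cross the boundary.\<close>
  then have "\<exists>a b. a \<in> ?S \<and> b \<notin> ?S \<and> {a, b} \<in># E"
    using w(2)
  proof (induction rule: rtrancl_induct)
    case base
    then show ?case using \<open>r \<in> ?S\<close> by simp
  next
    case (step y z)
    then show ?case by (cases "y \<in> ?S") auto
  qed
  then obtain m b where m: "m < k" and b: "b \<notin> ?S" and e: "{\<sigma> m, b} \<in># E" by auto
  have bv: "b < v" using e conn by (auto simp: connected_multigraph_def multigraph_def)
  let ?\<sigma> = "\<sigma>(k := b)" and ?p = "p(k := m)"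
  have "inj_on ?\<sigma> {..<Suc k}" "?\<sigma> ` {..<Suc k} \<subseteq> {..<v}" "?\<sigma> 0 = r"
    using \<sigma> b bv Suc.hyps by (auto simp: lessThan_Suc inj_on_def)
  moreover have "?p i < i \<and> {?\<sigma> i, ?\<sigma> (?p i)} \<in># E" if "i \<in> {1..<Suc k}" for i
  proof (cases "i = k")
    case True
    then show ?thesis using m e by (simp add: insert_commute)
  next
    case False
    then have "i \<in> {1..<k}" using that by auto
    then show ?thesis using p[of i] by auto
  qed
  ultimately show ?case by blast
qed

text \<open>A full ordering gives \<open>v - 1\<close> distinct tree edges inside \<open>E\<close>;
  as \<open>E\<close> has just that many edges with multiplicity, the two multisets agree.\<close>

lemma tree_ordering:
  assumes conn: "connected_multigraph v E" and size: "size E = v - 1" and r: "r < v"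
  obtains \<sigma> p where "\<sigma> permutes {..<v}" "\<sigma> 0 = r" "parent_map v p"
    "E = image_mset (image \<sigma>) (tree_graph v p)"
proof -
  obtain \<tau> p where \<tau>: "inj_on \<tau> {..<v}" "\<tau> ` {..<v} \<subseteq> {..<v}" "\<tau> 0 = r"
    and "\<forall>i\<in>{1..<v}. p i < i \<and> {\<tau> i, \<tau> (p i)} \<in># E"
    using partial_ordering[OF conn r, of v] r by (metis One_nat_def Suc_leI gr0I not_less0 order_refl)
  then have p: "p i < i \<and> {\<tau> i, \<tau> (p i)} \<in># E" if "i \<in> {1..<v}" for i using that by blast
  \<comment> \<open>Outside the vertex set the map is the identity, as \<open>permutes\<close>
    demands.\<close>
  define \<sigma> where "\<sigma> i = (if i < v then \<tau> i else i)" for i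
  have "bij_betw \<tau> {..<v} {..<v}"
    using \<tau> endo_inj_surj[of "{..<v}" \<tau>] by (auto simp: bij_betw_def)
  then have "bij_betw \<sigma> {..<v} {..<v}" by (simp add: \<sigma>_def bij_betw_def inj_on_def image_def)
  then have \<sigma>: "\<sigma> permutes {..<v}" by (rule bij_imp_permutes) (simp add: \<sigma>_def)
  have pm: "parent_map v p" using p by (simp add: parent_map_def)
  have "inj (image \<sigma>)" using permutes_inj[OF \<sigma>] by (intro inj_on_image) simp
  then have inj: "inj_on (\<lambda>i. \<sigma> ` {i, p i}) {1..<v}"
    using comp_inj_on[OF tree_edge_inj[OF pm] inj_on_subset[of "image \<sigma>" UNIV]] unfolding o_def by simp
  have "image_mset (image \<sigma>) (tree_graph v p) = image_mset (\<lambda>i. \<sigma> ` {i, p i}) (mset_set {1..<v})"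
    by (simp add: tree_graph_def image_mset.compositionality o_def)
  also have "\<dots> = mset_set ((\<lambda>i. \<sigma> ` {i, p i}) ` {1..<v})" by (rule image_mset_mset_set[OF inj])
  finally have eq: "image_mset (image \<sigma>) (tree_graph v p) = mset_set ((\<lambda>i. \<sigma> ` {i, p i}) ` {1..<v})" .
  have "(\<lambda>i. \<sigma> ` {i, p i}) ` {1..<v} \<subseteq> set_mset E"
  proof
    fix e assume "e \<in> (\<lambda>i. \<sigma> ` {i, p i}) ` {1..<v}"
    then obtain i where i: "i \<in> {1..<v}" "e = \<sigma> ` {i, p i}" by auto
    have "p i < v" using p[OF i(1)] i(1) by auto
    then show "e \<in># E" using p[OF i(1)] i by (simp add: \<sigma>_def)
  qed
  then have "image_mset (image \<sigma>) (tree_graph v p) \<subseteq># E"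
    unfolding eq by (meson finite_set_mset mset_set_set_mset_msubset subset_imp_msubset_mset_set subset_mset.order_trans)
  then have "E = image_mset (image \<sigma>) (tree_graph v p)"
    using size by (metis size_image_mset size_tree_graph mset_subset_size subset_mset.le_imp_less_or_eq less_irrefl)
  then show thesis using that[OF \<sigma> _ pm] \<tau>(3) r by (simp add: \<sigma>_def)
qed

lemma mg_degree_tree_graph_card:
  "mg_degree (tree_graph v p) i = card {k \<in> {1..<v}. i \<in> {k, p k}}"
  by (simp add: mg_degree_def tree_graph_def filter_mset_image_mset filter_mset_mset_set)

text \<open>The degree bounds make \<open>p\<close> injective on the non-root vertices, and an
  injective parent map must be the predecessor map.\<close>

lemma parent_map_path:
  assumes p: "parent_map v p" and root: "mg_degree (tree_graph v p) 0 \<le> 1"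
    and deg: "\<And>i. i < v \<Longrightarrow> mg_degree (tree_graph v p) i \<le> 2" and i: "i \<in> {1..<v}"
  shows "p i = i - 1"
proof -
  \<comment> \<open>Two children already give a vertex degree 2, too much for the root; elsewhere
    the edge to its own parent makes it 3.\<close>
  have inj: "i = j" if ij: "i \<in> {1..<v}" "j \<in> {1..<v}" "p i = p j" for i j
  proof (rule ccontr)
    assume "i \<noteq> j"
    have sub: "{i, j} \<subseteq> {k \<in> {1..<v}. p i \<in> {k, p k}}" using ij by auto
    have ne: "p i \<noteq> i" "p i \<noteq> j" "p i < v" using ij parent_mapD[OF p, of i] parent_mapD[OF p, of j] by auto
    show False
    proof (cases "p i = 0")
      case True
      have "card {i, j} \<le> mg_degree (tree_graph v p) (p i)"
        unfolding mg_degree_tree_graph_card by (intro card_mono sub) simp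
      then show False using True root \<open>i \<noteq> j\<close> by simp
    next
      case False
      have "{p i, i, j} \<subseteq> {k \<in> {1..<v}. p i \<in> {k, p k}}" using sub False ne by auto
      then have "card {p i, i, j} \<le> mg_degree (tree_graph v p) (p i)"
        unfolding mg_degree_tree_graph_card by (intro card_mono) simp
      then show False using deg[OF ne(3)] \<open>i \<noteq> j\<close> ne by simp
    qed
  qed
  show ?thesis using i
  proof (induction i rule: less_induct)
    case (less i)
    have "p i < i" using parent_mapD[OF p] less.prems by simp
    show ?case
    proof (rule ccontr)
      assume "p i \<noteq> i - 1"
      then have q: "Suc (p i) < i" using \<open>p i < i\<close> by simp
      \<comment> \<open>The vertex after \<open>p i\<close> has \<open>p i\<close> as its parent
        too, so injectivity identifies it with \<open>i\<close>.\<close>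
      then have "p (Suc (p i)) = p i" using less.IH[OF q] less.prems by simp
      then have "Suc (p i) = i" using inj[of "Suc (p i)" i] q less.prems by simp
      then show False using q by simp
    qed
  qed
qed

lemma parent_map_pred: "parent_map v (\<lambda>i. i - 1)"
  by (auto simp: parent_map_def)

lemma tree_count_le_1:
  assumes "connected_multigraph v E" "size E = v - 1" "0 < v"
  shows "count E e \<le> 1"
proof -
  obtain \<sigma> p where \<sigma>: "\<sigma> permutes {..<v}" and p: "parent_map v p"
    and E: "E = image_mset (image \<sigma>) (tree_graph v p)"
    using tree_ordering[OF assms] by blast
  have "inj (image \<sigma>)" using permutes_inj[OF \<sigma>] by (simp add: inj_on_def inj_image_eq_iff)
  have "E = image_mset (image \<sigma>) (mset_set ((\<lambda>i. {i, p i}) ` {1..<v}))"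
    unfolding E tree_graph_def image_mset_mset_set[OF tree_edge_inj[OF p]] ..
  also have "\<dots> = mset_set (image \<sigma> ` (\<lambda>i. {i, p i}) ` {1..<v})"
    by (rule image_mset_mset_set[OF inj_on_subset[OF \<open>inj (image \<sigma>)\<close> subset_UNIV]])
  finally have "E = mset_set (image \<sigma> ` (\<lambda>i. {i, p i}) ` {1..<v})" .
  then show ?thesis by (simp add: count_mset_set')
qed

text \<open>The value depends on \<open>v\<close> alone, so all trees share it; this settles
  \<open>y = 0\<close> in the \<open>D\<close>-criterion.\<close>

lemma tree_spectrum_prod:
  assumes "connected_multigraph v E" "size E = v - 1" "0 < v"
  shows "(\<Prod>\<rho>\<in>#laplacian_spectrum (laplacian v E). \<rho>) =
    det (mat (v - 1) (v - 1) (\<lambda>(i, j). (if i = j then 2 else 1) :: real))"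
proof -
  obtain \<sigma> p where \<sigma>: "\<sigma> permutes {..<v}" and p: "parent_map v p"
    and E: "E = image_mset (image \<sigma>) (tree_graph v p)"
    using tree_ordering[OF assms] by blast
  obtain n where n: "v = Suc n" using assms(3) by (cases v) auto
  show ?thesis
    using laplacian_spectrum_split(3)[OF multigraph_tree_graph] det_reduced_laplacian_tree p n
    unfolding E laplacian_spectrum_relabel[OF \<sigma>] by simp
qed

text \<open>Rooted at a vertex of degree at most 1, the tree has the predecessor map as parent map,
  so it is a relabelled path.\<close>

lemma tree_degree_le_2_spectrum:
  assumes conn: "connected_multigraph v E" and size: "size E = v - 1" and v: "0 < v"
    and deg: "\<And>i. i < v \<Longrightarrow> mg_degree E i \<le> 2"
  shows "laplacian_spectrum (laplacian v E) = laplacian_spectrum (laplacian v (path_graph v))"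
proof -
  have "(\<Sum>i<v. mg_degree E i) = 2 * (v - 1)"
    using sum_mg_degree conn size by (simp add: connected_multigraph_def)
  \<comment> \<open>If all degrees were at least 2, their sum would exceed
    \<open>2 * (v - 1)\<close>.\<close>
  moreover have "(\<Sum>i<v. 2) \<le> (\<Sum>i<v. mg_degree E i)" if "\<not> (\<exists>r<v. mg_degree E r \<le> 1)"
    using that by (intro sum_mono) (force simp: not_le)
  ultimately obtain r where r: "r < v" "mg_degree E r \<le> 1"
    using v by fastforce
  obtain \<sigma> p where \<sigma>: "\<sigma> permutes {..<v}" "\<sigma> 0 = r" and p: "parent_map v p"
    and E: "E = image_mset (image \<sigma>) (tree_graph v p)"
    using tree_ordering[OF conn size r(1)] by blast
  have dg: "mg_degree (tree_graph v p) i = mg_degree E (\<sigma> i)" for i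
    unfolding E by (rule mg_degree_relabel[OF permutes_inj[OF \<sigma>(1)], symmetric])
  have "p i = i - 1" if "i \<in> {1..<v}" for i
    using parent_map_path[OF p _ _ that] dg deg r(2) \<sigma>(2) permutes_in_image[OF \<sigma>(1)] by simp
  then have "tree_graph v p = path_graph v"
    unfolding path_graph_eq_tree_graph tree_graph_def by (intro image_mset_cong) simp
  then show ?thesis unfolding E laplacian_spectrum_relabel[OF \<sigma>(1)] by simp
qed

lemma connected_path_graph: "connected_multigraph v (path_graph v)"
proof -
  let ?R = "{(a, b). {a, b} \<in># path_graph v}"
  have sym: "sym ?R" by (auto simp: sym_def insert_commute)
  have "(0, i) \<in> ?R\<^sup>*" if "i < v" for i
    using that
  proof (induction i)
    case (Suc i)
    then have "(i, Suc i) \<in> ?R" by (auto simp: path_graph_def)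
    then show ?case using Suc by (meson Suc_lessD rtrancl.rtrancl_into_rtrancl)
  qed simp
  then have "(i, j) \<in> ?R\<^sup>*" if "i < v" "j < v" for i j
    using that sym_rtrancl[OF sym] by (meson rtrancl_trans symD)
  then show ?thesis
    using multigraph_tree_graph[OF parent_map_pred]
    by (simp add: connected_multigraph_def path_graph_eq_tree_graph)
qed

lemma size_path_graph: "size (path_graph v) = v - 1"
  by (simp add: path_graph_def)

section \<open>Power sums of the Laplacian spectrum\<close>

text \<open>Gershgorin's theorem, with the degree as both centre and radius; the row is one where
  the eigenvector is largest in absolute value. Eigenvalues are thus nonnegative, and at most 4 if
  all degrees are at most 2.\<close>

lemma laplacian_eigenvalue_disc:
  assumes E: "multigraph v E" and \<rho>: "\<rho> \<in># proots (char_poly (laplacian v E))"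
  shows "\<exists>i<v. \<bar>\<rho> - mg_degree E i\<bar> \<le> mg_degree E i"
proof -
  let ?L = "laplacian v E"
  have L: "?L \<in> carrier_mat v v" by simp
  have "char_poly ?L \<noteq> 0" using degree_monic_char_poly[OF L] by force
  then have "poly (char_poly ?L) \<rho> = 0" using \<rho> by simp
  then obtain u where u: "eigenvector ?L u \<rho>"
    using eigenvalue_root_char_poly[OF L] by (auto simp: eigenvalue_def)
  then have uc: "u \<in> carrier_vec v" and u0: "u \<noteq> 0\<^sub>v v" using L by (auto simp: eigenvector_def)
  have v: "{..<v} \<noteq> {}"
  proof
    assume "{..<v} = {}"
    then have "u = 0\<^sub>v v" using uc by (intro eq_vecI) auto
    then show False using u0 by simp
  qed
  define m where "m = Max ((\<lambda>j. \<bar>u $ j\<bar>) ` {..<v})"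
  have "m \<in> (\<lambda>j. \<bar>u $ j\<bar>) ` {..<v}" unfolding m_def using v by (intro Max_in) auto
  then obtain i where i: "i < v" "m = \<bar>u $ i\<bar>" by auto
  have le: "\<bar>u $ j\<bar> \<le> \<bar>u $ i\<bar>" if "j < v" for j
    unfolding i(2)[symmetric] m_def using that by (intro Max_ge) auto
  have pos: "\<bar>u $ i\<bar> > 0"
  proof (rule ccontr)
    assume "\<not> \<bar>u $ i\<bar> > 0"
    then have "u $ j = 0" if "j < v" for j using le[OF that] by simp
    then have "u = 0\<^sub>v v" using uc by (intro eq_vecI) auto
    then show False using u0 by simp
  qed
  have "\<rho> * u $ i = (\<Sum>j<v. ?L $$ (i, j) * u $ j)" using eigenvector_entry[OF L u i(1)] by simp
  also have "\<dots> = (\<Sum>j<v. (if i = j then mg_degree E i * u $ j else 0) - count E {i, j} * u $ j)"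
    by (intro sum.cong refl) (use i in \<open>simp add: laplacian_index algebra_simps\<close>)
  also have "\<dots> = mg_degree E i * u $ i - (\<Sum>j<v. count E {i, j} * u $ j)"
    using i by (simp add: sum_subtractf)
  finally have "(\<rho> - mg_degree E i) * u $ i = - (\<Sum>j<v. count E {i, j} * u $ j)"
    by (simp add: algebra_simps)
  then have "\<bar>\<rho> - mg_degree E i\<bar> * \<bar>u $ i\<bar> = \<bar>\<Sum>j<v. count E {i, j} * u $ j\<bar>"
    by (simp add: abs_mult[symmetric])
  also have "\<dots> \<le> (\<Sum>j<v. count E {i, j} * \<bar>u $ i\<bar>)"
    using le by (intro order_trans[OF sum_abs] sum_mono) (auto simp: abs_mult intro: mult_left_mono)
  also have "\<dots> = mg_degree E i * \<bar>u $ i\<bar>"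
    using mg_degree_eq_sum_count[OF E i(1)] by (simp add: sum_distrib_right)
  finally show ?thesis using pos i(1) by (auto simp: mult_le_cancel_right)
qed

text \<open>Expansion of the traces of the square and the cube of degree matrix minus adjacency
  matrix. Idempotent entries turn sums of squares into degrees; the last sum counts closed walks of
  length three.\<close>

lemma trace_powers_degree_minus_adjacency:
  fixes a :: "nat \<Rightarrow> nat \<Rightarrow> real" and d :: "nat \<Rightarrow> real"
  assumes diag: "\<And>i. i < v \<Longrightarrow> a i i = 0" and sym: "\<And>i j. a i j = a j i"
    and simple: "\<And>i j. a i j * a i j = a i j" and deg: "\<And>i. i < v \<Longrightarrow> d i = (\<Sum>j<v. a i j)"
  defines "l \<equiv> \<lambda>i j. (if i = j then d i else 0) - a i j"
  shows "(\<Sum>i<v. \<Sum>j<v. l i j * l j i) = (\<Sum>i<v. d i ^ 2) + (\<Sum>i<v. d i)"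
    and "(\<Sum>i<v. \<Sum>j<v. \<Sum>k<v. l i j * l j k * l k i) =
      (\<Sum>i<v. d i ^ 3) + 3 * (\<Sum>i<v. d i ^ 2) - (\<Sum>i<v. \<Sum>j<v. \<Sum>k<v. a i j * a j k * a k i)"
proof -
  have "(\<Sum>j<v. l i j * l j i) = d i ^ 2 + d i" if i: "i < v" for i
  proof -
    have "(\<Sum>j<v. l i j * l j i) = (\<Sum>j<v. (if i = j then d i ^ 2 else 0) + a i j)"
      using i diag simple sym[of _ i] by (intro sum.cong) (auto simp: l_def power2_eq_square)
    then show ?thesis using i deg by (simp add: sum.distrib)
  qed
  then show "(\<Sum>i<v. \<Sum>j<v. l i j * l j i) = (\<Sum>i<v. d i ^ 2) + (\<Sum>i<v. d i)"
    by (simp add: sum.distrib)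
  \<comment> \<open>\<open>left\<close> and \<open>right\<close> split one factor \<open>l\<close>
    at a time into its degree part and its adjacency part.\<close>
  have left: "(\<Sum>j<v. l i j * f j) = d i * f i - (\<Sum>j<v. a i j * f j)" if "i < v" for i and f :: "nat \<Rightarrow> real"
  proof -
    have "(\<Sum>j<v. l i j * f j) = (\<Sum>j<v. (if i = j then d i * f i else 0) - a i j * f j)"
      by (intro sum.cong) (auto simp: l_def algebra_simps)
    then show ?thesis using that by (simp add: sum_subtractf)
  qed
  have right: "(\<Sum>k<v. f k * l k i) = f i * d i - (\<Sum>k<v. f k * a k i)" if "i < v" for i and f :: "nat \<Rightarrow> real"
  proof -
    have "(\<Sum>k<v. f k * l k i) = (\<Sum>k<v. l i k * f k)"
      by (intro sum.cong) (auto simp: l_def sym mult.commute)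
    then show ?thesis unfolding left[OF that] by (simp add: sym mult.commute)
  qed
  have deg2: "(\<Sum>k<v. a i k * a k i) = d i" if "i < v" for i
  proof -
    have "a i k * a k i = a i k" for k using simple[of i k] sym[of k i] by simp
    then show ?thesis by (simp only: deg[OF that])
  qed
  have "(\<Sum>j<v. \<Sum>k<v. l i j * l j k * l k i) =
      d i ^ 3 + 2 * d i ^ 2 + (\<Sum>k<v. a i k * d k) - (\<Sum>j<v. \<Sum>k<v. a i j * a j k * a k i)"
    if i: "i < v" for i
  proof -
    have lki: "(\<Sum>k<v. l j k * l k i) = l j i * d i - (\<Sum>k<v. l j k * a k i)" for j
      by (rule right[OF i])
    have lka: "(\<Sum>k<v. l j k * a k i) = d j * a j i - (\<Sum>k<v. a j k * a k i)" if "j < v" for j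
      by (rule left[OF that])
    have "(\<Sum>j<v. \<Sum>k<v. l i j * l j k * l k i) = (\<Sum>j<v. l i j * (\<Sum>k<v. l j k * l k i))"
      by (simp add: sum_distrib_left mult.assoc)
    also have "\<dots> = d i * (\<Sum>k<v. l i k * l k i) - (\<Sum>j<v. a i j * (\<Sum>k<v. l j k * l k i))"
      by (rule left[OF i])
    also have "(\<Sum>k<v. l i k * l k i) = d i ^ 2 + d i"
      using i by fact
    also have "(\<Sum>j<v. a i j * (\<Sum>k<v. l j k * l k i)) =
        (\<Sum>j<v. (a i j * l j i) * d i - a i j * d j * a j i + (\<Sum>k<v. a i j * a j k * a k i))"
    proof (intro sum.cong refl)
      fix j assume "j \<in> {..<v}"
      then have "(\<Sum>k<v. l j k * l k i) = l j i * d i - (d j * a j i - (\<Sum>k<v. a j k * a k i))"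
        by (simp only: lki lka lessThan_iff)
      then show "a i j * (\<Sum>k<v. l j k * l k i) =
          (a i j * l j i) * d i - a i j * d j * a j i + (\<Sum>k<v. a i j * a j k * a k i)"
        by (simp add: sum_distrib_left mult.assoc right_diff_distrib)
    qed
    also have "\<dots> = (\<Sum>j<v. a i j * l j i) * d i - (\<Sum>j<v. a i j * d j) + (\<Sum>j<v. \<Sum>k<v. a i j * a j k * a k i)"
    proof -
      have "a i j * d j * a j i = a i j * d j" for j using simple[of i j] sym[of j i] by (simp add: mult_ac)
      then show ?thesis by (simp only: sum.distrib sum_subtractf sum_distrib_right)
    qed
    also have "(\<Sum>j<v. a i j * l j i) = - d i"
      unfolding right[OF i] using diag[OF i] deg2[OF i] by simp
    finally show ?thesis by (simp add: power2_eq_square power3_eq_cube algebra_simps)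
  qed
  then have "(\<Sum>i<v. \<Sum>j<v. \<Sum>k<v. l i j * l j k * l k i) =
      (\<Sum>i<v. d i ^ 3 + 2 * d i ^ 2 + (\<Sum>k<v. a i k * d k) - (\<Sum>j<v. \<Sum>k<v. a i j * a j k * a k i))"
    by simp
  \<comment> \<open>After the swap \<open>d k\<close> is summed over the neighbours of
    \<open>k\<close>, hence \<open>d k\<close> times.\<close>
  also have "(\<Sum>i<v. \<Sum>k<v. a i k * d k) = (\<Sum>k<v. d k ^ 2)"
  proof -
    have "(\<Sum>i<v. \<Sum>k<v. a i k * d k) = (\<Sum>k<v. d k * (\<Sum>i<v. a k i))"
      by (subst sum.swap) (simp add: sum_distrib_left sym mult.commute)
    then show ?thesis using deg by (simp add: power2_eq_square)
  qed
  then have "(\<Sum>i<v. d i ^ 3 + 2 * d i ^ 2 + (\<Sum>k<v. a i k * d k) - (\<Sum>j<v. \<Sum>k<v. a i j * a j k * a k i)) =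
      (\<Sum>i<v. d i ^ 3) + 3 * (\<Sum>i<v. d i ^ 2) - (\<Sum>i<v. \<Sum>j<v. \<Sum>k<v. a i j * a j k * a k i)"
    by (simp add: sum.distrib sum_subtractf sum_distrib_left[symmetric])
  finally show "(\<Sum>i<v. \<Sum>j<v. \<Sum>k<v. l i j * l j k * l k i) =
      (\<Sum>i<v. d i ^ 3) + 3 * (\<Sum>i<v. d i ^ 2) - (\<Sum>i<v. \<Sum>j<v. \<Sum>k<v. a i j * a j k * a k i)" .
qed

text \<open>The removed root 0 contributes nothing, so the power sums are the full traces.\<close>

lemma simple_laplacian_power_sums:
  assumes E: "multigraph v E" and v: "0 < v" and simple: "\<And>e. count E e \<le> 1"
  defines "M \<equiv> laplacian_spectrum (laplacian v E)"
  shows "(\<Sum>\<rho>\<in>#M. \<rho>) = (\<Sum>i<v. real (mg_degree E i))"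
    and "(\<Sum>\<rho>\<in>#M. \<rho> ^ 2) = (\<Sum>i<v. real (mg_degree E i) ^ 2) + (\<Sum>i<v. real (mg_degree E i))"
    and "(\<Sum>\<rho>\<in>#M. \<rho> ^ 3) = (\<Sum>i<v. real (mg_degree E i) ^ 3) + 3 * (\<Sum>i<v. real (mg_degree E i) ^ 2)
      - (\<Sum>i<v. \<Sum>j<v. \<Sum>k<v. real (count E {i, j}) * real (count E {j, k}) * real (count E {k, i}))"
proof -
  let ?L = "laplacian v E"
  obtain n where n: "v = Suc n" using v by (cases v) auto
  have pr: "proots (char_poly ?L) = add_mset 0 M"
    unfolding M_def using laplacian_spectrum_split(1)[of n E] E n by simp
  have diag: "count E {i} = 0" for i using E by (auto simp: multigraph_def count_eq_zero_iff)
  have idem: "real (count E e) * real (count E e) = real (count E e)" for e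
    using simple[of e] by (cases "count E e") auto
  have deg: "real (mg_degree E i) = (\<Sum>j<v. real (count E {i, j}))" if "i < v" for i
    using mg_degree_eq_sum_count[OF E that] by simp
  define l where "l i j = (if i = j then real (mg_degree E i) else 0) - real (count E {i, j})" for i j
  have l: "?L $$ (i, j) = l i j" if "i < v" "j < v" for i j
    using that by (simp add: laplacian_index l_def)
  have tr: "(\<Sum>i<v. \<Sum>j<v. l i j * l j i) =
      (\<Sum>i<v. real (mg_degree E i) ^ 2) + (\<Sum>i<v. real (mg_degree E i))"
    "(\<Sum>i<v. \<Sum>j<v. \<Sum>k<v. l i j * l j k * l k i) =
      (\<Sum>i<v. real (mg_degree E i) ^ 3) + 3 * (\<Sum>i<v. real (mg_degree E i) ^ 2)
      - (\<Sum>i<v. \<Sum>j<v. \<Sum>k<v. real (count E {i, j}) * real (count E {j, k}) * real (count E {k, i}))"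
    unfolding l_def
    by (rule trace_powers_degree_minus_adjacency[where a = "\<lambda>i j. real (count E {i, j})"
          and d = "\<lambda>i. real (mg_degree E i)"]; simp add: diag idem deg insert_commute)+
  note sps = symmetric_power_sums[OF laplacian_carrier laplacian_symmetric, of v E]
  show "(\<Sum>\<rho>\<in>#M. \<rho>) = (\<Sum>i<v. real (mg_degree E i))"
    using sps(3) by (simp add: pr laplacian_index diag)
  have "(\<Sum>\<rho>\<in>#M. \<rho> ^ 2) = (\<Sum>i<v. \<Sum>j<v. ?L $$ (i, j) * ?L $$ (j, i))"
    using sps(4) by (simp add: pr)
  also have "\<dots> = (\<Sum>i<v. \<Sum>j<v. l i j * l j i)"
    by (intro sum.cong refl) (simp add: l)
  finally show "(\<Sum>\<rho>\<in>#M. \<rho> ^ 2) =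
      (\<Sum>i<v. real (mg_degree E i) ^ 2) + (\<Sum>i<v. real (mg_degree E i))"
    by (simp only: tr)
  have "(\<Sum>\<rho>\<in>#M. \<rho> ^ 3) = (\<Sum>i<v. \<Sum>j<v. \<Sum>k<v. ?L $$ (i, j) * ?L $$ (j, k) * ?L $$ (k, i))"
    using sps(5) by (simp add: pr)
  also have "\<dots> = (\<Sum>i<v. \<Sum>j<v. \<Sum>k<v. l i j * l j k * l k i)"
    by (intro sum.cong refl) (simp add: l)
  finally show "(\<Sum>\<rho>\<in>#M. \<rho> ^ 3) = (\<Sum>i<v. real (mg_degree E i) ^ 3) + 3 * (\<Sum>i<v. real (mg_degree E i) ^ 2)
      - (\<Sum>i<v. \<Sum>j<v. \<Sum>k<v. real (count E {i, j}) * real (count E {j, k}) * real (count E {k, i}))"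
    by (simp only: tr)
qed

section \<open>Comparing multisets through their power sums\<close>

text \<open>Taylor expansion of \<open>1 / (X + t)\<close> at \<open>t = 0\<close> with exact
  remainder, where \<open>X = x + 2\<close> and \<open>t = \<rho> - 2\<close>. For equal size and
  equal first moment only the remainder matters.\<close>

lemma sum_inverse_second_order:
  fixes M :: "real multiset" and x :: real
  assumes "\<And>\<rho>. \<rho> \<in># M \<Longrightarrow> 0 \<le> \<rho>" "x > 0"
  shows "(\<Sum>\<rho>\<in>#M. 1 / (x + \<rho>)) = size M / (x + 2) - (\<Sum>\<rho>\<in>#M. \<rho> - 2) / (x + 2)\<^sup>2
    + (\<Sum>\<rho>\<in>#M. (\<rho> - 2)\<^sup>2 / (x + \<rho>)) / (x + 2)\<^sup>2"
  using assms(1)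
proof (induction M)
  case (add \<rho> M)
  have "0 \<le> \<rho>" using add.prems by simp
  then have "1 / (x + \<rho>) = 1 / (x + 2) - (\<rho> - 2) / (x + 2)\<^sup>2 + (\<rho> - 2)\<^sup>2 / (x + \<rho>) / (x + 2)\<^sup>2"
    using assms(2) by (simp add: divide_simps) (simp add: algebra_simps power2_eq_square)
  then show ?case using add by (simp add: add_divide_distrib diff_divide_distrib)
qed simp

text \<open>The tangent form \<open>1 / a \<ge> 2 c - c\<^sup>2 a\<close> of the Cauchy-Schwarz inequality.\<close>
lemma sum_second_order_lower:
  fixes M :: "real multiset" and x c :: real
  assumes "\<And>\<rho>. \<rho> \<in># M \<Longrightarrow> 0 \<le> \<rho>" "x > 0"
  shows "2 * c * (\<Sum>\<rho>\<in>#M. (\<rho> - 2)\<^sup>2) - c\<^sup>2 * ((x + 2) * (\<Sum>\<rho>\<in>#M. (\<rho> - 2)\<^sup>2) + (\<Sum>\<rho>\<in>#M. (\<rho> - 2) ^ 3))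
    \<le> (\<Sum>\<rho>\<in>#M. (\<rho> - 2)\<^sup>2 / (x + \<rho>))"
  using assms(1)
proof (induction M)
  case (add \<rho> M)
  have pos: "x + \<rho> > 0" using add.prems[of \<rho>] assms(2) by simp
  \<comment> \<open>The tangent inequality at \<open>a = x + \<rho>\<close>, as a square divided by
    a positive number.\<close>
  have "0 \<le> (1 - c * (x + \<rho>))\<^sup>2 / (x + \<rho>)" using pos by simp
  also have "\<dots> = 1 / (x + \<rho>) - 2 * c + c\<^sup>2 * (x + \<rho>)"
    using pos by (simp add: field_simps power2_eq_square)
  finally have "(\<rho> - 2)\<^sup>2 * (2 * c - c\<^sup>2 * (x + \<rho>)) \<le> (\<rho> - 2)\<^sup>2 * (1 / (x + \<rho>))"
    by (intro mult_left_mono) auto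
  moreover have "(\<rho> - 2)\<^sup>2 * (2 * c - c\<^sup>2 * (x + \<rho>)) =
      2 * c * (\<rho> - 2)\<^sup>2 - c\<^sup>2 * ((x + 2) * (\<rho> - 2)\<^sup>2 + (\<rho> - 2) ^ 3)"
    by (simp add: algebra_simps power2_eq_square power3_eq_cube)
  ultimately show ?case using add by (simp add: algebra_simps)
qed simp

text \<open>Since \<open>t = \<rho> - 2\<close> lies between -2 and 2,
  \<open>(X - t) * (X + t)\<close> is at least \<open>X^2 - 4\<close> for \<open>X = x + 2\<close>;
  this bounds \<open>1 / (X + t)\<close> by a linear function of \<open>t\<close>.\<close>

lemma sum_second_order_upper:
  fixes M :: "real multiset" and x :: real
  assumes "\<And>\<rho>. \<rho> \<in># M \<Longrightarrow> 0 \<le> \<rho> \<and> \<rho> \<le> 4" "x > 0"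
  shows "(\<Sum>\<rho>\<in>#M. (\<rho> - 2)\<^sup>2 / (x + \<rho>)) \<le>
    ((x + 2) * (\<Sum>\<rho>\<in>#M. (\<rho> - 2)\<^sup>2) - (\<Sum>\<rho>\<in>#M. (\<rho> - 2) ^ 3)) / ((x + 2)\<^sup>2 - 4)"
  using assms(1)
proof (induction M)
  case (add \<rho> M)
  have \<rho>: "0 \<le> \<rho>" "\<rho> \<le> 4" using add.prems[of \<rho>] by auto
  then have pos: "x + \<rho> > 0" and pos': "(x + 2)\<^sup>2 - 4 > 0"
    using assms(2) by (auto simp: power2_eq_square algebra_simps add_pos_pos)
  have "(\<rho> - 2)\<^sup>2 \<le> 4"
    using \<rho> mult_nonneg_nonneg[of \<rho> "4 - \<rho>"] by (simp add: power2_eq_square algebra_simps)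
  then have "(x + 2)\<^sup>2 - 4 \<le> (x + 2 - (\<rho> - 2)) * (x + \<rho>)"
    by (simp add: power2_eq_square algebra_simps)
  then have "1 / (x + \<rho>) \<le> (x + 2 - (\<rho> - 2)) / ((x + 2)\<^sup>2 - 4)"
    using pos pos' by (simp add: divide_simps)
  then have "(\<rho> - 2)\<^sup>2 * (1 / (x + \<rho>)) \<le> (\<rho> - 2)\<^sup>2 * ((x + 2 - (\<rho> - 2)) / ((x + 2)\<^sup>2 - 4))"
    by (rule mult_left_mono) simp
  also have "\<dots> = ((x + 2) * (\<rho> - 2)\<^sup>2 - (\<rho> - 2) ^ 3) / ((x + 2)\<^sup>2 - 4)"
    by (simp add: algebra_simps power2_eq_square power3_eq_cube)
  finally show ?case using add by (simp add: algebra_simps add_divide_distrib diff_divide_distrib)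
qed simp

text \<open>\<open>N\<close> stands for the path and \<open>M\<close> for a tree with a vertex of
  degree at least 3. The upper bound for \<open>N\<close> and the lower bound for \<open>M\<close>
  reduce the claim to an inequality between rational functions of \<open>X\<close>, \<open>n\<close>
  and \<open>q\<close>.\<close>

lemma sum_inverse_compare:
  fixes M N :: "real multiset" and n x q :: real
  assumes M: "\<And>\<rho>. \<rho> \<in># M \<Longrightarrow> 0 \<le> \<rho>" and N: "\<And>\<rho>. \<rho> \<in># N \<Longrightarrow> 0 \<le> \<rho> \<and> \<rho> \<le> 4"
    and size: "size M = size N" and S1: "(\<Sum>\<rho>\<in>#M. \<rho> - 2) = (\<Sum>\<rho>\<in>#N. \<rho> - 2)"
    and M2: "(\<Sum>\<rho>\<in>#M. (\<rho> - 2)\<^sup>2) = 2 * n - 2 + q" and M3: "(\<Sum>\<rho>\<in>#M. (\<rho> - 2) ^ 3) \<le> n * q"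
    and N2: "(\<Sum>\<rho>\<in>#N. (\<rho> - 2)\<^sup>2) = 2 * n - 2" and N3: "(\<Sum>\<rho>\<in>#N. (\<rho> - 2) ^ 3) = 0"
    and n: "n \<ge> 1" and q: "q \<ge> 2" and x: "x \<ge> n + 1"
  shows "(\<Sum>\<rho>\<in>#N. 1 / (x + \<rho>)) \<le> (\<Sum>\<rho>\<in>#M. 1 / (x + \<rho>))"
proof -
  have x0: "x > 0" using n x by simp
  define X where "X = x + 2"
  have X: "X \<ge> n + 3" using x by (simp add: X_def)
  define s where "s = 2 * n - 2 + q"
  have s: "s > 0" using n q by (simp add: s_def)
  have den: "X * s + n * q > 0" using s n q X by (intro add_pos_pos mult_pos_pos) auto
  have X4: "X\<^sup>2 - 4 > 0"
    using mult_strict_mono[of 2 X 2 X] X n by (simp add: power2_eq_square)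
  have "(\<Sum>\<rho>\<in>#N. (\<rho> - 2)\<^sup>2 / (x + \<rho>)) \<le> X * (2 * n - 2) / (X\<^sup>2 - 4)"
    using sum_second_order_upper[of N x, OF N x0] by (simp add: N2 N3 X_def)
  also have "\<dots> \<le> s\<^sup>2 / (X * s + n * q)"
  proof -
    \<comment> \<open>\<open>k\<close> is the second moment of \<open>N\<close>; the assumption
      \<open>x \<ge> n + 1\<close> becomes \<open>k \<le> 2 * X - 8\<close>.\<close>
    define k where "k = 2 * n - 2"
    have k: "0 \<le> k" "k \<le> 2 * X - 8" "n = k / 2 + 1" "s = k + q" using n X by (auto simp: k_def s_def field_simps)
    \<comment> \<open>The expression in \<open>q\<close> of the next bound, taken at the least value
      \<open>q = 2\<close>. The bound on \<open>k\<close> leaves a factor \<open>16 - 2 * X\<close>,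
      whose sign decides the cases.\<close>
    have "0 \<le> 4 * (X\<^sup>2 - 4) + 2 * (k * (3 * X - 8 - 2 * k))"
    proof (cases "X \<le> 8")
      case True
      have "0 \<le> k * (16 - 2 * X)" using k True by simp
      also have "\<dots> \<le> k * (6 * X - 16 - 4 * k)" using k by (intro mult_left_mono) auto
      finally show ?thesis using X4 by (simp add: algebra_simps)
    next
      case False
      have "(2 * X - 8) * (16 - 2 * X) \<le> k * (16 - 2 * X)" using k False by (intro mult_right_mono_neg) auto
      also have "\<dots> \<le> k * (6 * X - 16 - 4 * k)" using k by (intro mult_left_mono) auto
      finally show ?thesis using False by (simp add: algebra_simps power2_eq_square)
    qed
    also have "\<dots> \<le> q\<^sup>2 * (X\<^sup>2 - 4) + q * (k * (3 * X - 8)) - 4 * k\<^sup>2"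
    proof -
      have "2\<^sup>2 * (X\<^sup>2 - 4) \<le> q\<^sup>2 * (X\<^sup>2 - 4)"
        using q X4 by (intro mult_right_mono power_mono) auto
      moreover have "2 * (k * (3 * X - 8)) \<le> q * (k * (3 * X - 8))"
        using q k X n by (intro mult_right_mono mult_nonneg_nonneg) auto
      ultimately show ?thesis by (simp add: algebra_simps power2_eq_square)
    qed
    \<comment> \<open>The added term is nonnegative, again by the bound on \<open>k\<close>, and
      completes the difference of the cross products.\<close>
    also have "\<dots> \<le> q\<^sup>2 * (X\<^sup>2 - 4) + q * (k * (3 * X - 8)) - 4 * k\<^sup>2 + X * k * q * (X - k / 2 - 4)"
      using k q X n by simp
    also have "\<dots> = s\<^sup>2 * (X\<^sup>2 - 4) - X * k * (X * s + n * q)"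
      unfolding k(3,4) by (simp add: algebra_simps power2_eq_square)
    finally have "X * k * (X * s + n * q) \<le> s\<^sup>2 * (X\<^sup>2 - 4)" by simp
    then show ?thesis
      unfolding k_def[symmetric] using den X4 by (simp add: divide_simps mult.commute)
  qed
  also have "\<dots> \<le> (\<Sum>\<rho>\<in>#M. (\<rho> - 2)\<^sup>2 / (x + \<rho>))"
  proof -
    \<comment> \<open>This \<open>c\<close> maximizes the quadratic lower bound once the third
      moment is replaced by its bound \<open>n * q\<close>.\<close>
    define c where "c = s / (X * s + n * q)"
    have "s\<^sup>2 / (X * s + n * q) = 2 * c * s - c\<^sup>2 * (X * s + n * q)"
      using den by (simp add: c_def power2_eq_square divide_simps)
    also have "\<dots> \<le> 2 * c * s - c\<^sup>2 * (X * s + (\<Sum>\<rho>\<in>#M. (\<rho> - 2) ^ 3))"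
      using M3 by (intro diff_left_mono mult_left_mono add_left_mono) auto
    also have "\<dots> \<le> (\<Sum>\<rho>\<in>#M. (\<rho> - 2)\<^sup>2 / (x + \<rho>))"
      using sum_second_order_lower[of M x c, OF M x0] by (simp add: M2 X_def s_def)
    finally show ?thesis .
  qed
  finally have "(\<Sum>\<rho>\<in>#N. (\<rho> - 2)\<^sup>2 / (x + \<rho>)) \<le> (\<Sum>\<rho>\<in>#M. (\<rho> - 2)\<^sup>2 / (x + \<rho>))" .
  then have "(\<Sum>\<rho>\<in>#N. (\<rho> - 2)\<^sup>2 / (x + \<rho>)) / (x + 2)\<^sup>2 \<le> (\<Sum>\<rho>\<in>#M. (\<rho> - 2)\<^sup>2 / (x + \<rho>)) / (x + 2)\<^sup>2"
    by (intro divide_right_mono) auto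
  then show ?thesis
    using sum_inverse_second_order[of M x, OF M x0] sum_inverse_second_order[of N x, OF _ x0] N size S1 by simp
qed

text \<open>The logarithm \<open>h\<close> of the ratio of the products is nondecreasing from
  \<open>x0\<close> on and tends to 0 at infinity, so it is at most 0 at \<open>x0\<close>.\<close>

lemma prod_compare_from_sum_inverse:
  fixes M N :: "real multiset" and x0 :: real
  assumes M: "\<And>\<rho>. \<rho> \<in># M \<Longrightarrow> 0 \<le> \<rho>" and N: "\<And>\<rho>. \<rho> \<in># N \<Longrightarrow> 0 \<le> \<rho>"
    and size: "size M = size N" and x0: "x0 > 0"
    and le: "\<And>x. x \<ge> x0 \<Longrightarrow> (\<Sum>\<rho>\<in>#N. 1 / (x + \<rho>)) \<le> (\<Sum>\<rho>\<in>#M. 1 / (x + \<rho>))"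
  shows "(\<Prod>\<rho>\<in>#M. x0 + \<rho>) \<le> (\<Prod>\<rho>\<in>#N. x0 + \<rho>)"
proof -
  define G where "G A x = (\<Sum>\<rho>\<in>#A. ln (x + \<rho>))" for A :: "real multiset" and x :: real
  have der: "(G A has_real_derivative (\<Sum>\<rho>\<in>#A. 1 / (x + \<rho>))) (at x)"
    if "\<And>\<rho>. \<rho> \<in># A \<Longrightarrow> 0 \<le> \<rho>" "x > 0" for A x
    using that(1)
  proof (induction A)
    case empty
    then show ?case by (simp add: G_def)
  next
    case (add \<rho> A)
    have "((\<lambda>x. ln (x + \<rho>)) has_real_derivative 1 / (x + \<rho>)) (at x)"
      using add.prems[of \<rho>] that(2) by (auto intro!: derivative_eq_intros)
    moreover have "(G A has_real_derivative (\<Sum>\<rho>\<in>#A. 1 / (x + \<rho>))) (at x)"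
      using add by simp
    ultimately have "((\<lambda>x. ln (x + \<rho>) + G A x) has_real_derivative 1 / (x + \<rho>) + (\<Sum>\<rho>\<in>#A. 1 / (x + \<rho>))) (at x)"
      by (rule DERIV_add)
    then show ?case by (simp add: G_def)
  qed
  \<comment> \<open>Each logarithmic sum is \<open>size A * ln x\<close> up to a vanishing error;
    equal sizes cancel the main terms in \<open>h\<close>.\<close>
  have lim: "((\<lambda>x. G A x - size A * ln x) \<longlongrightarrow> 0) at_top" for A
  proof (induction A)
    case (add \<rho> A)
    have "((\<lambda>x. ln (x + \<rho>) - ln x) \<longlongrightarrow> 0) at_top" by real_asymp
    from tendsto_add[OF this add.IH] show ?case
      by (simp add: G_def algebra_simps)
  qed (simp add: G_def)
  define h where "h x = G M x - G N x" for x
  have "((\<lambda>x. (G M x - size M * ln x) - (G N x - size N * ln x)) \<longlongrightarrow> 0 - 0) at_top"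
    by (intro tendsto_diff lim)
  then have hlim: "(h \<longlongrightarrow> 0) at_top" by (simp add: h_def[abs_def] size)
  have mono: "h x0 \<le> h x" if "x \<ge> x0" for x
  proof (rule DERIV_nonneg_imp_nondecreasing[OF that])
    fix y assume y: "x0 \<le> y" "y \<le> x"
    then have "(h has_real_derivative (\<Sum>\<rho>\<in>#M. 1 / (y + \<rho>)) - (\<Sum>\<rho>\<in>#N. 1 / (y + \<rho>))) (at y)"
      unfolding h_def[abs_def] using x0 M N by (intro DERIV_diff der) auto
    then show "\<exists>z. (h has_real_derivative z) (at y) \<and> 0 \<le> z" using le[OF y(1)] by auto
  qed
  have "h x0 \<le> 0"
    by (rule tendsto_lowerbound[OF hlim eventually_mono[OF eventually_ge_at_top[of x0]]]) (use mono in auto)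
  moreover have "(\<Prod>\<rho>\<in>#A. x0 + \<rho>) = exp (G A x0)" if "\<And>\<rho>. \<rho> \<in># A \<Longrightarrow> 0 \<le> \<rho>" for A
    using that x0 by (induction A) (auto simp: G_def exp_add add_pos_nonneg)
  ultimately show ?thesis using M N by (simp add: h_def)
qed

section \<open>Trees compared with the path\<close>

lemma sum_mset_shift:
  fixes M :: "real multiset"
  shows "(\<Sum>\<rho>\<in>#M. \<rho> - 2) = (\<Sum>\<rho>\<in>#M. \<rho>) - 2 * size M"
    and "(\<Sum>\<rho>\<in>#M. (\<rho> - 2)\<^sup>2) = (\<Sum>\<rho>\<in>#M. \<rho>\<^sup>2) - 4 * (\<Sum>\<rho>\<in>#M. \<rho>) + 4 * size M"
    and "(\<Sum>\<rho>\<in>#M. (\<rho> - 2) ^ 3) =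
      (\<Sum>\<rho>\<in>#M. \<rho> ^ 3) - 6 * (\<Sum>\<rho>\<in>#M. \<rho>\<^sup>2) + 12 * (\<Sum>\<rho>\<in>#M. \<rho>) - 8 * size M"
  by (induction M) (simp_all add: algebra_simps power2_eq_square power3_eq_cube)

text \<open>The degree polynomials are chosen to vanish at degrees 1 and 2, so that the path makes
  both sums zero. The handshake lemma eliminates the linear degree terms.\<close>

lemma tree_centered_power_sums:
  assumes conn: "connected_multigraph v E" and size: "size E = v - 1" and v: "0 < v"
  defines "M \<equiv> laplacian_spectrum (laplacian v E)" and "d \<equiv> \<lambda>i. real (mg_degree E i)"
  defines "q \<equiv> \<Sum>i<v. (d i - 1) * (d i - 2)"
  shows "size M = v - 1" and "(\<Sum>\<rho>\<in>#M. \<rho> - 2) = 0"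
    and "(\<Sum>\<rho>\<in>#M. (\<rho> - 2)\<^sup>2) = 2 * real (v - 1) - 2 + q"
    and "(\<Sum>\<rho>\<in>#M. (\<rho> - 2) ^ 3) = 3 * q + (\<Sum>i<v. (d i - 1) * (d i - 2) * (d i - 3))
      - (\<Sum>i<v. \<Sum>j<v. \<Sum>k<v. real (count E {i, j}) * real (count E {j, k}) * real (count E {k, i}))"
    and "\<rho> \<in># M \<Longrightarrow> \<exists>i<v. \<bar>\<rho> - d i\<bar> \<le> d i"
proof -
  have E: "multigraph v E" using conn by (simp add: connected_multigraph_def)
  obtain n where n: "v = Suc n" using v by (cases v) auto
  show sM: "size M = v - 1" using laplacian_spectrum_split(2)[of n E] E n by (simp add: M_def)
  have D1: "(\<Sum>i<v. d i) = 2 * real (v - 1)"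
    using sum_mg_degree[OF E] size unfolding d_def of_nat_sum[symmetric] by simp
  have d: "real (mg_degree E i) = d i" for i by (simp add: d_def)
  note ps = simple_laplacian_power_sums[OF E v tree_count_le_1[OF conn size v], folded M_def, unfolded d]
  show "(\<Sum>\<rho>\<in>#M. \<rho> - 2) = 0" unfolding sum_mset_shift sM using ps(1) D1 by simp
  have q: "q = (\<Sum>i<v. d i ^ 2) - 4 * real (v - 1) + 2"
  proof -
    have "q = (\<Sum>i<v. d i ^ 2 - 3 * d i + 2)"
      unfolding q_def by (intro sum.cong) (auto simp: algebra_simps power2_eq_square)
    also have "\<dots> = (\<Sum>i<v. d i ^ 2) - 3 * (\<Sum>i<v. d i) + 2 * real v"
      by (simp add: sum.distrib sum_subtractf sum_distrib_left)
    finally show ?thesis using D1 n by (simp add: algebra_simps)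
  qed
  show "(\<Sum>\<rho>\<in>#M. (\<rho> - 2)\<^sup>2) = 2 * real (v - 1) - 2 + q"
    unfolding sum_mset_shift sM using ps(1,2) D1 q by simp
  have "(\<Sum>i<v. (d i - 1) * (d i - 2) * (d i - 3)) = (\<Sum>i<v. d i ^ 3 - 6 * d i ^ 2 + 11 * d i - 6)"
    by (intro sum.cong) (auto simp: algebra_simps power2_eq_square power3_eq_cube)
  also have "\<dots> = (\<Sum>i<v. d i ^ 3) - 6 * (\<Sum>i<v. d i ^ 2) + 11 * (\<Sum>i<v. d i) - 6 * real v"
    by (simp add: sum.distrib sum_subtractf sum_distrib_left)
  finally show "(\<Sum>\<rho>\<in>#M. (\<rho> - 2) ^ 3) = 3 * q + (\<Sum>i<v. (d i - 1) * (d i - 2) * (d i - 3))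
      - (\<Sum>i<v. \<Sum>j<v. \<Sum>k<v. real (count E {i, j}) * real (count E {j, k}) * real (count E {k, i}))"
    unfolding sum_mset_shift sM using ps D1 q n by (simp add: algebra_simps)
  assume "\<rho> \<in># M"
  then have "\<rho> \<in># proots (char_poly (laplacian v E))"
    using laplacian_spectrum_split(1)[of n E] E n by (simp add: M_def)
  then show "\<exists>i<v. \<bar>\<rho> - d i\<bar> \<le> d i" unfolding d_def by (rule laplacian_eigenvalue_disc[OF E])
qed

lemma mg_degree_path_graph:
  assumes "i < v" "2 \<le> v"
  shows "mg_degree (path_graph v) i = 1 \<or> mg_degree (path_graph v) i = 2"
proof -
  have "mg_degree (path_graph v) i = card {k \<in> {1..<v}. i \<in> {k, k - 1}}"
    unfolding path_graph_eq_tree_graph by (rule mg_degree_tree_graph_card)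
  also have "{k \<in> {1..<v}. i \<in> {k, k - 1}} = (if i = 0 then {1} else if Suc i = v then {i} else {i, Suc i})"
    using assms by auto
  finally show ?thesis by simp
qed

lemma count_path_graph_nonzero:
  assumes "count (path_graph v) {i, j} \<noteq> 0"
  shows "j = Suc i \<or> i = Suc j"
proof -
  have "{i, j} \<in># path_graph v" using assms by (simp add: count_eq_zero_iff)
  then show ?thesis by (auto simp: path_graph_def doubleton_eq_iff)
qed

text \<open>All degrees are 1 or 2, which kills the degree polynomials and puts the discs into the
  interval from 0 to 4.\<close>

lemma path_spectrum:
  assumes v: "2 \<le> v"
  defines "N \<equiv> laplacian_spectrum (laplacian v (path_graph v))"
  shows "(\<Sum>\<rho>\<in>#N. (\<rho> - 2)\<^sup>2) = 2 * real (v - 1) - 2" and "(\<Sum>\<rho>\<in>#N. (\<rho> - 2) ^ 3) = 0"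
    and "\<rho> \<in># N \<Longrightarrow> 0 \<le> \<rho> \<and> \<rho> \<le> 4"
proof -
  let ?d = "\<lambda>i. real (mg_degree (path_graph v) i)"
  have "0 < v" using v by simp
  note cps = tree_centered_power_sums[OF connected_path_graph size_path_graph this, folded N_def]
  have q: "(\<Sum>i<v. (?d i - 1) * (?d i - 2)) = 0"
    using mg_degree_path_graph[OF _ v] by (intro sum.neutral) force
  have c: "(\<Sum>i<v. (?d i - 1) * (?d i - 2) * (?d i - 3)) = 0"
    using mg_degree_path_graph[OF _ v] by (intro sum.neutral) force
  \<comment> \<open>Three numbers cannot pairwise differ by exactly one, so a path has no
    triangles.\<close>
  have t: "real (count (path_graph v) {i, j}) * real (count (path_graph v) {j, k}) *
      real (count (path_graph v) {k, i}) = 0" for i j k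
    using count_path_graph_nonzero[of v i j] count_path_graph_nonzero[of v j k]
      count_path_graph_nonzero[of v k i] by fastforce
  show "(\<Sum>\<rho>\<in>#N. (\<rho> - 2)\<^sup>2) = 2 * real (v - 1) - 2" using cps(3) q by simp
  show "(\<Sum>\<rho>\<in>#N. (\<rho> - 2) ^ 3) = 0" unfolding cps(4) q c t by simp
  assume "\<rho> \<in># N"
  then obtain i where "i < v" "\<bar>\<rho> - ?d i\<bar> \<le> ?d i" using cps(5) by auto
  then show "0 \<le> \<rho> \<and> \<rho> \<le> 4" using mg_degree_path_graph[of i v] v by auto
qed

lemma tree_spectrum_nonneg:
  assumes "connected_multigraph v E" "size E = v - 1" "0 < v"
    and "\<rho> \<in># laplacian_spectrum (laplacian v E)"
  shows "0 \<le> \<rho>"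
  using tree_centered_power_sums(5)[OF assms] by auto

text \<open>Edges of a tree are simple, so every other vertex contributes at most 1.\<close>

lemma tree_degree_less:
  assumes "connected_multigraph v E" "size E = v - 1" and i: "i < v"
  shows "mg_degree E i \<le> v - 1"
proof -
  have E: "multigraph v E" using assms by (simp add: connected_multigraph_def)
  have "count E {i} = 0" using E by (auto simp: multigraph_def count_eq_zero_iff)
  have "mg_degree E i = (\<Sum>j<v. count E {i, j})" by (rule mg_degree_eq_sum_count[OF E i])
  also have "\<dots> \<le> (\<Sum>j<v. if j = i then 0 else 1)"
    using \<open>count E {i} = 0\<close> tree_count_le_1[OF assms(1,2)] i by (intro sum_mono) auto
  also have "\<dots> = card ({..<v} - {i})"
    by (simp add: sum.If_cases set_diff_eq Int_def conj_commute)
  finally show ?thesis using i by simp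
qed

text \<open>No integer lies strictly between 1 and 2.\<close>

lemma int_pred_mult_nonneg: "0 \<le> (int d - 1) * (int d - 2)"
  by (cases "d \<le> 1") (auto intro: mult_nonpos_nonpos mult_nonneg_nonneg)

text \<open>With all degrees at most 2 the spectra coincide. Otherwise a vertex of degree at least 3
  gives \<open>q \<ge> 2\<close>, and the comparison through power sums applies with
  \<open>n = v - 1\<close>.\<close>

lemma tree_sum_inverse_ge_path:
  assumes v: "3 \<le> v" and conn: "connected_multigraph v E" and size: "size E = v - 1" and x: "real v \<le> x"
  shows "(\<Sum>\<rho>\<in>#laplacian_spectrum (laplacian v (path_graph v)). 1 / (x + \<rho>)) \<le>
    (\<Sum>\<rho>\<in>#laplacian_spectrum (laplacian v E). 1 / (x + \<rho>))"
proof (cases "\<forall>i<v. mg_degree E i \<le> 2")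
  case True
  then show ?thesis using tree_degree_le_2_spectrum[OF conn size] v by simp
next
  case False
  then obtain i0 where i0: "i0 < v" "mg_degree E i0 \<ge> 3" by force
  have v0: "0 < v" and v2: "2 \<le> v" using v by auto
  let ?d = "\<lambda>i. real (mg_degree E i)"
  define q where "q = (\<Sum>i<v. (?d i - 1) * (?d i - 2))"
  note cps = tree_centered_power_sums[OF conn size v0, folded q_def]
  note pps = tree_centered_power_sums[OF connected_path_graph size_path_graph v0]
  have nonneg: "0 \<le> (?d i - 1) * (?d i - 2)" for i
  proof -
    have "(?d i - 1) * (?d i - 2) = real_of_int ((int (mg_degree E i) - 1) * (int (mg_degree E i) - 2))"
      by simp
    then show ?thesis using int_pred_mult_nonneg[of "mg_degree E i"] by (metis of_int_0_le_iff)
  qed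
  have "2 \<le> (?d i0 - 1) * (?d i0 - 2)"
    using mult_mono[of 2 "?d i0 - 1" 1 "?d i0 - 2"] i0 by simp
  also have "\<dots> \<le> q" unfolding q_def using i0 nonneg by (intro member_le_sum) auto
  finally have q: "2 \<le> q" .
  \<comment> \<open>With degrees at most \<open>n = v - 1\<close> the cubic sum is at most
    \<open>(n - 3) * q\<close>; adding \<open>3 * q\<close> gives \<open>n * q\<close>, and the
    triangle sum is subtracted.\<close>
  have "?d i - 3 \<le> real (v - 1) - 3" if "i < v" for i
    using tree_degree_less[OF conn size that] by (simp del: of_nat_diff)
  then have "(\<Sum>i<v. (?d i - 1) * (?d i - 2) * (?d i - 3)) \<le>
      (\<Sum>i<v. (?d i - 1) * (?d i - 2) * (real (v - 1) - 3))"
    using nonneg by (intro sum_mono mult_left_mono) simp_all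
  also have "\<dots> = q * (real (v - 1) - 3)" by (simp add: q_def sum_distrib_right)
  finally have "3 * q + (\<Sum>i<v. (?d i - 1) * (?d i - 2) * (?d i - 3)) \<le> real (v - 1) * q"
    by (simp add: algebra_simps)
  moreover have "0 \<le> (\<Sum>i<v. \<Sum>j<v. \<Sum>k<v.
      real (count E {i, j}) * real (count E {j, k}) * real (count E {k, i}))"
    by (intro sum_nonneg) auto
  ultimately have S3: "(\<Sum>\<rho>\<in>#laplacian_spectrum (laplacian v E). (\<rho> - 2) ^ 3) \<le> real (v - 1) * q"
    unfolding cps(4) by simp
  show ?thesis
    by (rule sum_inverse_compare[OF tree_spectrum_nonneg[OF conn size v0] path_spectrum(3)[OF v2] _ _
          cps(3) S3 path_spectrum(1,2)[OF v2] _ q])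
      (use v x cps(1,2) pps(1,2) in auto)
qed

section \<open>The two optimality criteria\<close>

lemma D_value_le_path:
  assumes v: "3 \<le> v" and conn: "connected_multigraph v E" and size: "size E = v - 1"
  shows "D_value v y (laplacian v E) \<le> D_value v y (laplacian v (path_graph v))"
proof (cases "y = 0")
  case True
  have "0 < v" using v by simp
  then show ?thesis
    using tree_spectrum_prod[OF conn size] tree_spectrum_prod[OF connected_path_graph size_path_graph] True
    by (simp add: D_value_def)
next
  case False
  have v0: "0 < v" using v by simp
  have "real v * 1 \<le> real v * real y" using False by (intro mult_left_mono) auto
  \<comment> \<open>All points from \<open>v * y\<close> on lie in the range
    \<open>x \<ge> v\<close> where the inverse sums are comparable.\<close>
  then have y: "real v \<le> real v * real y" by simp
  show ?thesis
    unfolding D_value_def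
  proof (rule prod_compare_from_sum_inverse)
    show "size (laplacian_spectrum (laplacian v E)) = size (laplacian_spectrum (laplacian v (path_graph v)))"
      using tree_centered_power_sums(1)[OF conn size v0]
        tree_centered_power_sums(1)[OF connected_path_graph size_path_graph v0] by simp
  qed (use y v0 tree_spectrum_nonneg[OF conn size v0]
      tree_spectrum_nonneg[OF connected_path_graph size_path_graph v0]
      tree_sum_inverse_ge_path[OF v conn size order_trans[OF y]] in auto)
qed

lemma A_value_le_path:
  assumes v: "3 \<le> v" and conn: "connected_multigraph v E" and size: "size E = v - 1" and y: "1 \<le> y"
  shows "A_value v y (laplacian v E) \<le> A_value v y (laplacian v (path_graph v))"
proof -
  have v0: "0 < v" using v by simp
  have "real v * 1 \<le> real v * real y" using y by (intro mult_left_mono) auto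
  then have xy: "real v \<le> real v * real y" by simp
  let ?N = "laplacian_spectrum (laplacian v (path_graph v))"
  \<comment> \<open>A nonempty spectrum makes the inverse sum of the path positive; the other sum is
    at least as large, so the quotients can be compared.\<close>
  have "size ?N \<noteq> 0"
    using tree_centered_power_sums(1)[OF connected_path_graph size_path_graph v0] v by simp
  then obtain \<rho> N' where N': "?N = add_mset \<rho> N'" by (metis multiset_cases size_empty)
  have pos: "0 < 1 / (real v * real y + \<sigma>)" if "\<sigma> \<in># ?N" for \<sigma>
    using tree_spectrum_nonneg[OF connected_path_graph size_path_graph v0 that] y v0
    by (simp add: add_pos_nonneg)
  have "0 \<le> (\<Sum>\<sigma>\<in>#N'. 1 / (real v * real y + \<sigma>))"
    using sum_mset_mono[of N' "\<lambda>_. 0" "\<lambda>\<sigma>. 1 / (real v * real y + \<sigma>)"] pos N'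
    by (simp add: less_imp_le)
  then have "0 < (\<Sum>\<sigma>\<in>#?N. 1 / (real v * real y + \<sigma>))"
    using pos[of \<rho>] unfolding N' by (simp add: add_pos_nonneg)
  then show ?thesis
    unfolding A_value_def
    using tree_sum_inverse_ge_path[OF v conn size xy] v
    by (intro divide_left_mono mult_pos_pos) linarith+
qed

text \<open>A design is rated through an \<open>L\<close> whose augmentation is its Laplacian;
  injectivity makes that \<open>L\<close> unique.\<close>

lemma augment_inj:
  assumes "L \<in> carrier_mat v v" "L' \<in> carrier_mat v v" "augment v y L = augment v y L'"
  shows "L = L'"
proof (rule eq_matI)
  fix i j assume ij: "i < dim_row L'" "j < dim_col L'"
  have "augment v y L $$ (i, j) = augment v y L' $$ (i, j)" using assms(3) by simp
  then show "L $$ (i, j) = L' $$ (i, j)" using ij assms(1,2) by (simp add: augment_def)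
qed (use assms in auto)

theorem proposition3p1:
  fixes v :: nat
  assumes "v \<ge> 3"
  shows
    "(\<forall>y::nat. \<forall>E. connected_multigraph v E \<and>
        laplacian v E = augment v y (laplacian v (path_graph v)) \<longrightarrow>
        D_optimal v y (laplacians v (v - 1)) E) \<and>
     (\<forall>y::nat. y \<ge> 1 \<longrightarrow> (\<forall>E. connected_multigraph v E \<and>
        laplacian v E = augment v y (laplacian v (path_graph v)) \<longrightarrow>
        A_optimal v y (laplacians v (v - 1)) E)) \<and>
     (\<forall>L \<in> laplacians v (v - 1).
        (\<forall>y::nat. D_value v y (laplacian v (path_graph v)) \<ge> D_value v y L) \<and>
        (\<forall>y::nat. y \<ge> 1 \<longrightarrow>
           A_value v y (laplacian v (path_graph v)) \<ge> A_value v y L))"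
proof -
  let ?P = "laplacian v (path_graph v)" and ?C = "laplacians v (v - 1)"
  have P: "?P \<in> ?C" using connected_path_graph size_path_graph by (auto simp: laplacians_def)
  \<comment> \<open>Transfers inequalities between matrices to designs, for both criteria at
    once.\<close>
  have optimal: "optimal_design \<Phi> v y ?C E"
    if le: "\<forall>L\<in>?C. \<Phi> v y L \<le> \<Phi> v y ?P" and E: "connected_multigraph v E" "laplacian v E = augment v y ?P"
    for \<Phi> y E
    unfolding optimal_design_def designs_over_def
  proof (intro conjI ballI impI)
    fix L L' assume L: "L \<in> ?C" "L' \<in> ?C" and "laplacian v E = augment v y L"
    then have "L = ?P" using augment_inj[of L v ?P y] E(2) by (auto simp: laplacians_def)
    then show "\<Phi> v y L' \<le> \<Phi> v y L" using le L by simp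
  qed (use E P in auto)
  have D: "\<forall>L\<in>?C. D_value v y L \<le> D_value v y ?P" for y
    using D_value_le_path[OF assms] by (auto simp: laplacians_def)
  have A: "\<forall>L\<in>?C. A_value v y L \<le> A_value v y ?P" if "1 \<le> y" for y
    using A_value_le_path[OF assms _ _ that] by (auto simp: laplacians_def)
  show ?thesis using optimal D A by blast
qed

end
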